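(* Let $\mathcal M$ be a symplectic manifold, and let $\mathcal L\subset\mathcal T^*_\rho\mathcal M$ be the surface defined by $\theta_i\equiv\rho_i(x)-p_i=0$. Then $\mathcal L$ is a submanifold (a smooth section of $\mathcal T^*_\rho\mathcal M\to\mathcal M$), the constraints $\theta_i$ are second class, with $\{\theta_i,\theta_j\}=\omega_{ij}$, and $\mathcal L$ with the Dirac bracket $$\{f,g\}_D=\{f,g\}-\{f,\theta_i\}\,\omega^{ij}\,\{\theta_j,g\}$$ is isomorphic to $\mathcal M$ as a symplectic manifold: for any functions $f(x,p),g(x,p)$ on $\mathcal T^*_\rho\mathcal M$, $$\{f,g\}_D\big|_{p_i=\rho_i(x)}=\{f_0,g_0\}_{\mathcal M},\qquad f_0(x)=f(x,p)|_{p_i=\rho_i(x)},\quad g_0(x)=g(x,p)|_{p_i=\rho_i(x)}.$$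
   Context: The symplectic form on $\mathcal M$ has components $\omega_{ij}(x)$ (closed, nondegenerate) in local coordinates $x^i$, $\omega^{ij}\omega_{jk}=\delta^i_k$, and $\{a,b\}_{\mathcal M}=\omega^{ij}\partial_ia\,\partial_jb$. $\mathcal M$ is covered by coordinate domains $U_\alpha$ with local symplectic potentials $\rho^\alpha=\rho^\alpha_idx^i$, $\omega_{ij}=\partial_i\rho^\alpha_j-\partial_j\rho^\alpha_i$; on overlaps $\phi^{\alpha\beta}=\rho^\alpha-\rho^\beta=\phi^{\alpha\beta}_idx^i_\alpha$ is a closed 1-form. $\mathcal T^*_\rho\mathcal M$ is the affine bundle over $\mathcal M$ with fibre coordinates $p^\alpha_i$ over $U_\alpha$ and transition law $p^\alpha_i=p^\beta_j\,\partial x^j_\beta/\partial x^i_\alpha+\phi^{\alpha\beta}_i$. It carries the globally defined canonical Poisson bracket $$\{f,g\}=\frac{\partial f}{\partial x^i}\frac{\partial g}{\partial p_i}-\frac{\partial f}{\partial p_i}\frac{\partial g}{\partial x^i}.$$ Constraints are second class if the matrix of their mutual Poisson brackets is invertible. *)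

theory Defs
  imports "HOL-Analysis.Analysis"
begin

section \<open>Smooth maps between open subsets of normed spaces\<close>

text \<open>Meaningful for open \<^term>\<open>S\<close> only, since derivatives are taken in the full space.\<close>

primrec Ck_on :: "nat \<Rightarrow> 'a::real_normed_vector set \<Rightarrow> ('a \<Rightarrow> 'b::real_normed_vector) \<Rightarrow> bool" where
  "Ck_on 0 S f \<longleftrightarrow> continuous_on S f"
| "Ck_on (Suc k) S f \<longleftrightarrow>
     (\<forall>y\<in>S. f differentiable (at y)) \<and> (\<forall>v. Ck_on k S (\<lambda>y. frechet_derivative f (at y) v))"

definition smooth_on :: "'a::real_normed_vector set \<Rightarrow> ('a \<Rightarrow> 'b::real_normed_vector) \<Rightarrow> bool" where
  "smooth_on S f \<longleftrightarrow> (\<forall>k. Ck_on k S f)"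

definition partial :: "'n::finite \<Rightarrow> (real^'n \<Rightarrow> real) \<Rightarrow> real^'n \<Rightarrow> real" where
  "partial i F y = frechet_derivative F (at y) (axis i 1)"

definition partial_x :: "'n::finite \<Rightarrow> ((real^'n) \<times> (real^'n) \<Rightarrow> real) \<Rightarrow> (real^'n) \<times> (real^'n) \<Rightarrow> real" where
  "partial_x i F y = frechet_derivative F (at y) (axis i 1, 0)"

definition partial_p :: "'n::finite \<Rightarrow> ((real^'n) \<times> (real^'n) \<Rightarrow> real) \<Rightarrow> (real^'n) \<times> (real^'n) \<Rightarrow> real" where
  "partial_p i F y = frechet_derivative F (at y) (0, axis i 1)"


section \<open>Smooth manifolds\<close>

text \<open>The charts are indexed by the whole type \<^typ>\<open>'a\<close>; empty or repeated charts are harmless.\<close>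

record ('a, 'm, 'e) atlas =
  pts :: "'m topology"
  chart_dom :: "'a \<Rightarrow> 'm set"
  chart :: "'a \<Rightarrow> 'm \<Rightarrow> 'e"

definition chart_img :: "('a, 'm, 'e) atlas \<Rightarrow> 'a \<Rightarrow> 'e set" where
  "chart_img X \<alpha> = chart X \<alpha> ` chart_dom X \<alpha>"

definition chart_inv :: "('a, 'm, 'e) atlas \<Rightarrow> 'a \<Rightarrow> 'e \<Rightarrow> 'm" where
  "chart_inv X \<alpha> = inv_into (chart_dom X \<alpha>) (chart X \<alpha>)"

definition local_rep ::
  "('a, 'm, 'e) atlas \<Rightarrow> 'a \<Rightarrow> ('b, 'k, 'd) atlas \<Rightarrow> 'b \<Rightarrow> ('m \<Rightarrow> 'k) \<Rightarrow> 'e \<Rightarrow> 'd" where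
  "local_rep X \<alpha> Y \<beta> F = chart Y \<beta> \<circ> F \<circ> chart_inv X \<alpha>"

definition smooth_manifold :: "('a, 'm, 'e::euclidean_space) atlas \<Rightarrow> bool" where
  "smooth_manifold X \<longleftrightarrow>
     Hausdorff_space (pts X) \<and> second_countable (pts X) \<and>
     (\<Union>\<alpha>. chart_dom X \<alpha>) = topspace (pts X) \<and>
     (\<forall>\<alpha>. openin (pts X) (chart_dom X \<alpha>) \<and> open (chart_img X \<alpha>) \<and>
          homeomorphic_map (subtopology (pts X) (chart_dom X \<alpha>))
            (top_of_set (chart_img X \<alpha>)) (chart X \<alpha>)) \<and>
     (\<forall>\<alpha> \<beta>. smooth_on (chart X \<alpha> ` (chart_dom X \<alpha> \<inter> chart_dom X \<beta>))
               (local_rep X \<alpha> X \<beta> (\<lambda>m. m)))"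

definition smooth_fun :: "('a, 'm, 'e::euclidean_space) atlas \<Rightarrow> ('m \<Rightarrow> real) \<Rightarrow> bool" where
  "smooth_fun X f \<longleftrightarrow> (\<forall>\<alpha>. smooth_on (chart_img X \<alpha>) (f \<circ> chart_inv X \<alpha>))"

definition smooth_map ::
  "('a, 'm, 'e::euclidean_space) atlas \<Rightarrow> ('b, 'k, 'd::euclidean_space) atlas \<Rightarrow> ('m \<Rightarrow> 'k) \<Rightarrow> bool" where
  "smooth_map X Y F \<longleftrightarrow>
     continuous_map (pts X) (pts Y) F \<and>
     (\<forall>\<alpha> \<beta>. smooth_on (chart X \<alpha> ` {m \<in> chart_dom X \<alpha>. F m \<in> chart_dom Y \<beta>})
               (local_rep X \<alpha> Y \<beta> F))"

definition diffeomorphism ::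
  "('a, 'm, 'e::euclidean_space) atlas \<Rightarrow> ('b, 'k, 'd::euclidean_space) atlas \<Rightarrow> ('m \<Rightarrow> 'k) \<Rightarrow> bool" where
  "diffeomorphism X Y F \<longleftrightarrow>
     bij_betw F (topspace (pts X)) (topspace (pts Y)) \<and>
     smooth_map X Y F \<and> smooth_map Y X (inv_into (topspace (pts X)) F)"

text \<open>A subset is an embedded submanifold of dimension \<open>d\<close> if around each of its points there
  is a smooth change of coordinates \<open>\<Psi>\<close> that straightens it to a \<open>d\<close>-dimensional subspace.\<close>

definition embedded_submanifold :: "nat \<Rightarrow> ('a, 'm, 'e::euclidean_space) atlas \<Rightarrow> 'm set \<Rightarrow> bool" where
  "embedded_submanifold d X S \<longleftrightarrow>
     S \<subseteq> topspace (pts X) \<and>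
     (\<forall>e\<in>S. \<exists>\<alpha> W (\<Psi> :: 'e \<Rightarrow> 'e) T.
        e \<in> chart_dom X \<alpha> \<and> open W \<and> chart X \<alpha> e \<in> W \<and> W \<subseteq> chart_img X \<alpha> \<and>
        open (\<Psi> ` W) \<and> inj_on \<Psi> W \<and> smooth_on W \<Psi> \<and> smooth_on (\<Psi> ` W) (inv_into W \<Psi>) \<and>
        subspace T \<and> dim T = d \<and>
        \<Psi> ` (W \<inter> chart X \<alpha> ` (S \<inter> chart_dom X \<alpha>)) = \<Psi> ` W \<inter> T)"


section \<open>Symplectic manifolds\<close>

text \<open>A 2-form is given by its component matrices \<open>\<omega> \<alpha> y $ i $ j\<close> at the coordinate value
  \<open>y\<close> in the chart \<open>\<alpha>\<close>. The Jacobian entry \<open>jacobian f (at y) $ k $ i\<close> is the derivative of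
  the \<open>k\<close>-th component of \<open>f\<close> in direction \<open>i\<close>, so that \<open>transpose J ** B ** J\<close> is the
  pullback of \<open>B\<close>.\<close>

definition pullback_form ::
  "('a, 'm, real^'n) atlas \<Rightarrow> ('a \<Rightarrow> real^'n \<Rightarrow> real^'n^'n) \<Rightarrow>
   ('b, 'k, real^'n) atlas \<Rightarrow> ('b \<Rightarrow> real^'n \<Rightarrow> real^'n^'n) \<Rightarrow> ('m \<Rightarrow> 'k) \<Rightarrow> bool" where
  "pullback_form X \<omega> Y \<eta> F \<longleftrightarrow>
     (\<forall>\<alpha> \<beta>. \<forall>m \<in> chart_dom X \<alpha>. F m \<in> chart_dom Y \<beta> \<longrightarrow>
        (let J = jacobian (local_rep X \<alpha> Y \<beta> F) (at (chart X \<alpha> m))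
         in \<omega> \<alpha> (chart X \<alpha> m) = transpose J ** \<eta> \<beta> (chart Y \<beta> (F m)) ** J))"

definition symplectic_form ::
  "('a, 'm, real^'n) atlas \<Rightarrow> ('a \<Rightarrow> real^'n \<Rightarrow> real^'n^'n) \<Rightarrow> bool" where
  "symplectic_form X \<omega> \<longleftrightarrow>
     pullback_form X \<omega> X \<omega> (\<lambda>m. m) \<and>
     (\<forall>\<alpha>. smooth_on (chart_img X \<alpha>) (\<omega> \<alpha>) \<and>
       (\<forall>y \<in> chart_img X \<alpha>.
          (\<forall>i j. \<omega> \<alpha> y $ i $ j = - \<omega> \<alpha> y $ j $ i) \<and>
          (\<forall>i j k. partial i (\<lambda>y. \<omega> \<alpha> y $ j $ k) y + partial j (\<lambda>y. \<omega> \<alpha> y $ k $ i) y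
                 + partial k (\<lambda>y. \<omega> \<alpha> y $ i $ j) y = 0) \<and>
          invertible (\<omega> \<alpha> y)))"

definition symplectic_manifold ::
  "('a, 'm, real^'n) atlas \<Rightarrow> ('a \<Rightarrow> real^'n \<Rightarrow> real^'n^'n) \<Rightarrow> bool" where
  "symplectic_manifold X \<omega> \<longleftrightarrow> smooth_manifold X \<and> symplectic_form X \<omega>"

definition symplectomorphism ::
  "('a, 'm, real^'n) atlas \<Rightarrow> ('a \<Rightarrow> real^'n \<Rightarrow> real^'n^'n) \<Rightarrow>
   ('b, 'k, real^'n) atlas \<Rightarrow> ('b \<Rightarrow> real^'n \<Rightarrow> real^'n^'n) \<Rightarrow> ('m \<Rightarrow> 'k) \<Rightarrow> bool" where
  "symplectomorphism X \<omega> Y \<eta> F \<longleftrightarrow> diffeomorphism X Y F \<and> pullback_form X \<omega> Y \<eta> F"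

text \<open>The Poisson bracket of a symplectic manifold, computed in the chart \<open>\<alpha>\<close> at a point of
  its domain.\<close>

definition symplectic_bracket ::
  "('a, 'm, real^'n) atlas \<Rightarrow> ('a \<Rightarrow> real^'n \<Rightarrow> real^'n^'n) \<Rightarrow> 'a \<Rightarrow>
   ('m \<Rightarrow> real) \<Rightarrow> ('m \<Rightarrow> real) \<Rightarrow> 'm \<Rightarrow> real" where
  "symplectic_bracket X \<omega> \<alpha> a b m =
     (let y = chart X \<alpha> m in
      \<Sum>i\<in>UNIV. \<Sum>j\<in>UNIV. matrix_inv (\<omega> \<alpha> y) $ i $ j
         * partial i (a \<circ> chart_inv X \<alpha>) y * partial j (b \<circ> chart_inv X \<alpha>) y)"

definition symplectic_potential ::
  "('a, 'm, real^'n) atlas \<Rightarrow> ('a \<Rightarrow> real^'n \<Rightarrow> real^'n^'n) \<Rightarrow> ('a \<Rightarrow> real^'n \<Rightarrow> real^'n) \<Rightarrow> bool" where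
  "symplectic_potential X \<omega> \<rho> \<longleftrightarrow>
     (\<forall>\<alpha>. smooth_on (chart_img X \<alpha>) (\<rho> \<alpha>) \<and>
       (\<forall>y \<in> chart_img X \<alpha>. \<forall>i j.
          \<omega> \<alpha> y $ i $ j = partial i (\<lambda>y. \<rho> \<alpha> y $ j) y - partial j (\<lambda>y. \<rho> \<alpha> y $ i) y))"


section \<open>The affine bundle of a family of local symplectic potentials\<close>

text \<open>The entry \<open>$ j $ i\<close> is the derivative of the \<open>j\<close>-th \<open>\<beta>\<close>-coordinate with respect to the
  \<open>i\<close>-th \<open>\<alpha>\<close>-coordinate.\<close>

definition trans_jac :: "('a, 'm, real^'n) atlas \<Rightarrow> 'a \<Rightarrow> 'a \<Rightarrow> 'm \<Rightarrow> real^'n^'n" where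
  "trans_jac X \<alpha> \<beta> m = jacobian (local_rep X \<alpha> X \<beta> (\<lambda>m. m)) (at (chart X \<alpha> m))"

definition potential_diff ::
  "('a, 'm, real^'n) atlas \<Rightarrow> ('a \<Rightarrow> real^'n \<Rightarrow> real^'n) \<Rightarrow> 'a \<Rightarrow> 'a \<Rightarrow> 'm \<Rightarrow> real^'n" where
  "potential_diff X \<rho> \<alpha> \<beta> m =
     (\<chi> i. \<rho> \<alpha> (chart X \<alpha> m) $ i
          - (\<Sum>j\<in>UNIV. \<rho> \<beta> (chart X \<beta> m) $ j * trans_jac X \<alpha> \<beta> m $ j $ i))"

definition bundle_rel ::
  "('a, 'm, real^'n) atlas \<Rightarrow> ('a \<Rightarrow> real^'n \<Rightarrow> real^'n) \<Rightarrow> ('a \<times> 'm \<times> (real^'n)) rel" where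
  "bundle_rel X \<rho> = {((\<alpha>, m, p), (\<beta>, m', q)).
     m = m' \<and> m \<in> chart_dom X \<alpha> \<inter> chart_dom X \<beta> \<and>
     (\<forall>i. p $ i = (\<Sum>j\<in>UNIV. q $ j * trans_jac X \<alpha> \<beta> m $ j $ i) + potential_diff X \<rho> \<alpha> \<beta> m $ i)}"

text \<open>A point of the bundle is an equivalence class of triples (chart, base point, fibre
  coordinates in that chart).\<close>

definition bundle_pts ::
  "('a, 'm, real^'n) atlas \<Rightarrow> ('a \<Rightarrow> real^'n \<Rightarrow> real^'n) \<Rightarrow> ('a \<times> 'm \<times> (real^'n)) set set" where
  "bundle_pts X \<rho> = {(\<alpha>, m, p). m \<in> chart_dom X \<alpha>} // bundle_rel X \<rho>"

definition bundle_proj :: "('a \<times> 'm \<times> (real^'n)) set \<Rightarrow> 'm" where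
  "bundle_proj e = (THE m. \<exists>\<alpha> p. (\<alpha>, m, p) \<in> e)"

definition fibre_coord :: "'a \<Rightarrow> ('a \<times> 'm \<times> (real^'n)) set \<Rightarrow> real^'n" where
  "fibre_coord \<alpha> e = (THE p. (\<alpha>, bundle_proj e, p) \<in> e)"

definition bundle_dom ::
  "('a, 'm, real^'n) atlas \<Rightarrow> ('a \<Rightarrow> real^'n \<Rightarrow> real^'n) \<Rightarrow> 'a \<Rightarrow> ('a \<times> 'm \<times> (real^'n)) set set" where
  "bundle_dom X \<rho> \<alpha> = {e \<in> bundle_pts X \<rho>. bundle_proj e \<in> chart_dom X \<alpha>}"

definition bundle_chart ::
  "('a, 'm, real^'n) atlas \<Rightarrow> 'a \<Rightarrow> ('a \<times> 'm \<times> (real^'n)) set \<Rightarrow> (real^'n) \<times> (real^'n)" where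
  "bundle_chart X \<alpha> e = (chart X \<alpha> (bundle_proj e), fibre_coord \<alpha> e)"

definition affine_bundle ::
  "('a, 'm, real^'n) atlas \<Rightarrow> ('a \<Rightarrow> real^'n \<Rightarrow> real^'n) \<Rightarrow>
   ('a, ('a \<times> 'm \<times> (real^'n)) set, (real^'n) \<times> (real^'n)) atlas" where
  "affine_bundle X \<rho> =
     \<lparr> pts = topology_generated_by
         {{e \<in> bundle_dom X \<rho> \<alpha>. bundle_chart X \<alpha> e \<in> W} | \<alpha> W. open W},
       chart_dom = bundle_dom X \<rho>,
       chart = bundle_chart X \<rparr>"


section \<open>Canonical bracket, constraints and Dirac bracket\<close>

text \<open>All brackets are computed in the chart \<open>\<alpha>\<close>; the functions may be defined on the domain
  of that chart only.\<close>

definition canonical_bracket ::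
  "('a, 'm, real^'n) atlas \<Rightarrow> ('a \<Rightarrow> real^'n \<Rightarrow> real^'n) \<Rightarrow> 'a \<Rightarrow>
   (('a \<times> 'm \<times> (real^'n)) set \<Rightarrow> real) \<Rightarrow> (('a \<times> 'm \<times> (real^'n)) set \<Rightarrow> real) \<Rightarrow>
   ('a \<times> 'm \<times> (real^'n)) set \<Rightarrow> real" where
  "canonical_bracket X \<rho> \<alpha> f g e =
     (let F = f \<circ> chart_inv (affine_bundle X \<rho>) \<alpha>;
          G = g \<circ> chart_inv (affine_bundle X \<rho>) \<alpha>;
          y = bundle_chart X \<alpha> e
      in \<Sum>i\<in>UNIV. partial_x i F y * partial_p i G y - partial_p i F y * partial_x i G y)"

definition constraint ::
  "('a, 'm, real^'n) atlas \<Rightarrow> ('a \<Rightarrow> real^'n \<Rightarrow> real^'n) \<Rightarrow> 'a \<Rightarrow> 'n \<Rightarrow>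
   ('a \<times> 'm \<times> (real^'n)) set \<Rightarrow> real" where
  "constraint X \<rho> \<alpha> i e = \<rho> \<alpha> (chart X \<alpha> (bundle_proj e)) $ i - fibre_coord \<alpha> e $ i"

definition constraint_matrix ::
  "('a, 'm, real^'n) atlas \<Rightarrow> ('a \<Rightarrow> real^'n \<Rightarrow> real^'n) \<Rightarrow> 'a \<Rightarrow>
   ('a \<times> 'm \<times> (real^'n)) set \<Rightarrow> real^'n^'n" where
  "constraint_matrix X \<rho> \<alpha> e =
     (\<chi> i j. canonical_bracket X \<rho> \<alpha> (constraint X \<rho> \<alpha> i) (constraint X \<rho> \<alpha> j) e)"

definition constraints_second_class ::
  "('a, 'm, real^'n) atlas \<Rightarrow> ('a \<Rightarrow> real^'n \<Rightarrow> real^'n) \<Rightarrow> bool" where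
  "constraints_second_class X \<rho> \<longleftrightarrow>
     (\<forall>\<alpha>. \<forall>e \<in> bundle_dom X \<rho> \<alpha>. invertible (constraint_matrix X \<rho> \<alpha> e))"

definition constraint_surface ::
  "('a, 'm, real^'n) atlas \<Rightarrow> ('a \<Rightarrow> real^'n \<Rightarrow> real^'n) \<Rightarrow> ('a \<times> 'm \<times> (real^'n)) set set" where
  "constraint_surface X \<rho> =
     {e \<in> bundle_pts X \<rho>. \<forall>\<alpha> i. e \<in> bundle_dom X \<rho> \<alpha> \<longrightarrow> constraint X \<rho> \<alpha> i e = 0}"

definition dirac_bracket ::
  "('a, 'm, real^'n) atlas \<Rightarrow> ('a \<Rightarrow> real^'n \<Rightarrow> real^'n^'n) \<Rightarrow> ('a \<Rightarrow> real^'n \<Rightarrow> real^'n) \<Rightarrow> 'a \<Rightarrow>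
   (('a \<times> 'm \<times> (real^'n)) set \<Rightarrow> real) \<Rightarrow> (('a \<times> 'm \<times> (real^'n)) set \<Rightarrow> real) \<Rightarrow>
   ('a \<times> 'm \<times> (real^'n)) set \<Rightarrow> real" where
  "dirac_bracket X \<omega> \<rho> \<alpha> f g e =
     canonical_bracket X \<rho> \<alpha> f g e
     - (\<Sum>i\<in>UNIV. \<Sum>j\<in>UNIV.
          canonical_bracket X \<rho> \<alpha> f (constraint X \<rho> \<alpha> i) e
          * matrix_inv (\<omega> \<alpha> (chart X \<alpha> (bundle_proj e))) $ i $ j
          * canonical_bracket X \<rho> \<alpha> (constraint X \<rho> \<alpha> j) g e)"

text \<open>The submanifold \<open>\<L>\<close> with the subspace topology and the base coordinates \<open>x\<^sup>i\<close>
  as charts.\<close>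

definition surface_atlas ::
  "('a, 'm, real^'n) atlas \<Rightarrow> ('a \<Rightarrow> real^'n \<Rightarrow> real^'n) \<Rightarrow>
   ('a, ('a \<times> 'm \<times> (real^'n)) set, real^'n) atlas" where
  "surface_atlas X \<rho> =
     \<lparr> pts = subtopology (pts (affine_bundle X \<rho>)) (constraint_surface X \<rho>),
       chart_dom = (\<lambda>\<alpha>. constraint_surface X \<rho> \<inter> bundle_dom X \<rho> \<alpha>),
       chart = (\<lambda>\<alpha> e. chart X \<alpha> (bundle_proj e)) \<rparr>"

text \<open>The restriction to \<open>p\<^sub>i = \<rho>\<^sub>i(x)\<close> of a function \<open>f\<close> on the bundle, as a function on the
  base, is \<open>f \<circ> surface_section X \<rho>\<close>.\<close>

definition surface_section ::
  "('a, 'm, real^'n) atlas \<Rightarrow> ('a \<Rightarrow> real^'n \<Rightarrow> real^'n) \<Rightarrow> 'm \<Rightarrow> ('a \<times> 'm \<times> (real^'n)) set" where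
  "surface_section X \<rho> m = (THE e. e \<in> constraint_surface X \<rho> \<and> bundle_proj e = m)"

definition smooth_section ::
  "('a, 'm, real^'n) atlas \<Rightarrow> ('a \<Rightarrow> real^'n \<Rightarrow> real^'n) \<Rightarrow>
   ('m \<Rightarrow> ('a \<times> 'm \<times> (real^'n)) set) \<Rightarrow> bool" where
  "smooth_section X \<rho> s \<longleftrightarrow>
     smooth_map X (affine_bundle X \<rho>) s \<and> (\<forall>m \<in> topspace (pts X). bundle_proj (s m) = m)"

end

theory Submission
  imports Defs
begin

text \<open>In the shifted fibre coordinates \<open>p - \<rho>\<close> the transition law of the bundle is linear, so it is
  the cotangent bundle with \<open>\<L>\<close> as its zero section. Hence the base coordinates turn every
  statement about \<open>\<L>\<close> as a manifold into one about \<open>\<M>\<close>. With \<open>N\<close> the Jacobian of \<open>\<rho>\<close>, so that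
  \<open>\<omega> = N\<^sup>T - N\<close>, the brackets are \<open>{f,\<theta>} = -(f\<^sub>x + N f\<^sub>p)\<close> and \<open>{\<theta>,g} = g\<^sub>x + N g\<^sub>p\<close>, whereas the
  gradient of \<open>f\<^sub>0\<close> is \<open>f\<^sub>x + N\<^sup>T f\<^sub>p = f\<^sub>x + N f\<^sub>p + \<omega> f\<^sub>p\<close>; inserting \<open>\<omega>\<^sup>-\<^sup>1\<close> makes the extra terms
  reproduce exactly the canonical bracket \<open>{f,g}\<close>.\<close>

section \<open>Calculus of smooth maps\<close>

text \<open>Chart inverses are \<open>inv_into\<close> terms, so a \<open>local_rep\<close> agrees
  with the expected formula only on an open coordinate set and is arbitrary elsewhere. Smoothness,
  Frechet derivatives and Jacobians are therefore always transferred by congruence rules on open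
  sets. The total space is a quotient set with the topology generated by chart preimages. This makes
  the charts continuous by construction, but that they are open maps depends on continuity of the
  transition maps; hence an explicit smooth formula for the transition maps precedes the manifold
  axioms. Consistency of the gluing amounts to the chain rule for coordinate changes of
  \<open>M\<close>, because the affine cocycle is the difference of the potentials themselves. The
  form asked for on the surface can be taken to have the same component functions as
  \<open>\<omega>\<close>, since the surface charts have the same images and transition maps as
  those of \<open>M\<close>.\<close>

lemma Ck_on_cong:
  assumes "open S" "Ck_on k S f" "\<And>x. x \<in> S \<Longrightarrow> f x = g x"
  shows "Ck_on k S g"
  using assms(2,3)
proof (induction k arbitrary: f g)
  case 0
  then show ?case by (metis Ck_on.simps(1) continuous_on_cong)
next
  case (Suc k)
  have "g differentiable (at y)" "frechet_derivative g (at y) = frechet_derivative f (at y)"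
    if "y \<in> S" for y
  proof -
    have "(f has_derivative frechet_derivative f (at y)) (at y)"
      using Suc.prems(1) that frechet_derivative_works by auto
    then have "(g has_derivative frechet_derivative f (at y)) (at y)"
      by (rule has_derivative_transform_within_open[OF _ assms(1) that]) (simp add: Suc.prems(2))
    then show "g differentiable (at y)" "frechet_derivative g (at y) = frechet_derivative f (at y)"
      using differentiable_def frechet_derivative_at by (blast, metis)
  qed
  then show ?case
    using Suc.prems(1) Suc.IH[of "\<lambda>y. frechet_derivative f (at y) v" "\<lambda>y. frechet_derivative g (at y) v" for v]
    by simp
qed

text \<open>Uniqueness of the derivative identifies \<open>f'\<close> with
  \<open>frechet_derivative f\<close> on \<open>S\<close>. The closure properties below use this to
  work with explicit differentiation rules.\<close>

lemma Ck_on_SucI: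
  assumes "open S" "\<And>x. x \<in> S \<Longrightarrow> (f has_derivative f' x) (at x)"
    and "\<And>v. Ck_on k S (\<lambda>x. f' x v)"
  shows "Ck_on (Suc k) S f"
proof -
  have "frechet_derivative f (at x) = f' x" if "x \<in> S" for x
    using assms(2)[OF that] frechet_derivative_at by metis
  then show ?thesis
    using assms(2) Ck_on_cong[OF assms(1) assms(3)] by (auto simp: differentiable_def)
qed

text \<open>The recursion records differentiability and the class of the derivatives, not the class
  of \<open>f\<close> itself, so this descent needs an induction. Product and chain rule rely on it,
  since there \<open>f\<close> occurs undifferentiated beside its derivative.\<close>

lemma Ck_on_SucD:
  assumes "Ck_on (Suc k) S f"
  shows "Ck_on k S f"
  using assms
proof (induction k arbitrary: f)
  case 0
  then show ?case
    by (auto intro!: continuous_at_imp_continuous_on differentiable_imp_continuous_within)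
next
  case (Suc k)
  have d: "\<forall>y\<in>S. f differentiable (at y)"
    and c: "\<And>v. Ck_on (Suc k) S (\<lambda>y. frechet_derivative f (at y) v)"
    using Suc.prems[unfolded Ck_on.simps(2)[of "Suc k"]] by blast+
  show ?case
    unfolding Ck_on.simps(2) using d Suc.IH[OF c] by blast
qed

lemma Ck_on_const: "Ck_on k S (\<lambda>x. c)"
proof (induction k arbitrary: c)
  case (Suc k)
  then show ?case by simp
qed simp

lemma Ck_on_bounded_linear:
  assumes "open S" "bounded_linear f"
  shows "Ck_on k S f"
proof (cases k)
  case 0
  then show ?thesis
    using assms(2) by (simp add: linear_continuous_on)
next
  case (Suc l)
  show ?thesis
    unfolding Suc
    by (rule Ck_on_SucI[where f' = "\<lambda>_. f"])
      (use assms Ck_on_const bounded_linear_imp_has_derivative in auto)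
qed

lemma Ck_on_linear_comp:
  assumes "open S" "bounded_linear L" "Ck_on k S f"
  shows "Ck_on k S (\<lambda>x. L (f x))"
  using assms(3)
proof (induction k arbitrary: f)
  case 0
  then show ?case
    using bounded_linear.continuous_on[OF assms(2)] by simp
next
  case (Suc k)
  show ?case
  proof (rule Ck_on_SucI[where f' = "\<lambda>x v. L (frechet_derivative f (at x) v)"])
    fix x assume "x \<in> S"
    then show "((\<lambda>x. L (f x)) has_derivative (\<lambda>v. L (frechet_derivative f (at x) v))) (at x)"
      using Suc.prems by (intro bounded_linear.has_derivative[OF assms(2)])
        (simp add: frechet_derivative_works)
  qed (use assms(1) Suc in auto)
qed

lemma Ck_on_add:
  assumes "open S" "Ck_on k S f" "Ck_on k S g"
  shows "Ck_on k S (\<lambda>x. f x + g x)"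
  using assms(2,3)
proof (induction k arbitrary: f g)
  case 0
  then show ?case by (simp add: continuous_on_add)
next
  case (Suc k)
  show ?case
  proof (rule Ck_on_SucI[where f' = "\<lambda>x v. frechet_derivative f (at x) v + frechet_derivative g (at x) v"])
    fix x assume "x \<in> S"
    then show "((\<lambda>x. f x + g x) has_derivative
        (\<lambda>v. frechet_derivative f (at x) v + frechet_derivative g (at x) v)) (at x)"
      using Suc.prems by (intro has_derivative_add) (simp_all add: frechet_derivative_works)
  qed (use assms(1) Suc in auto)
qed

lemma Ck_on_sum:
  assumes "open S" "\<And>i. i \<in> I \<Longrightarrow> Ck_on k S (f i)"
  shows "Ck_on k S (\<lambda>x. \<Sum>i\<in>I. f i x)"
  using assms(2)
  by (induction I rule: infinite_finite_induct)
    (auto intro: Ck_on_const Ck_on_add[OF assms(1)])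

lemma Ck_on_bilinear:
  assumes "open S" "bounded_bilinear B" "Ck_on k S f" "Ck_on k S g"
  shows "Ck_on k S (\<lambda>x. B (f x) (g x))"
  using assms(3,4)
proof (induction k arbitrary: f g)
  case 0
  then show ?case
    using bounded_bilinear.continuous_on[OF assms(2)] by simp
next
  case (Suc k)
  show ?case
  proof (rule Ck_on_SucI[where f' = "\<lambda>x v. B (f x) (frechet_derivative g (at x) v)
        + B (frechet_derivative f (at x) v) (g x)"])
    fix x assume "x \<in> S"
    then show "((\<lambda>x. B (f x) (g x)) has_derivative
        (\<lambda>v. B (f x) (frechet_derivative g (at x) v) + B (frechet_derivative f (at x) v) (g x))) (at x)"
      using Suc.prems by (intro bounded_bilinear.FDERIV[OF assms(2)])
        (simp_all add: frechet_derivative_works)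
  next
    fix v
    show "Ck_on k S (\<lambda>x. B (f x) (frechet_derivative g (at x) v) + B (frechet_derivative f (at x) v) (g x))"
      using Suc.prems Suc.prems[THEN Ck_on_SucD]
      by (intro Ck_on_add[OF assms(1)] Suc.IH) simp_all
  qed (use assms(1) in auto)
qed

text \<open>\<open>Ck_on\<close> controls derivatives in a fixed direction, whereas the chain rule
  differentiates \<open>g\<close> in the direction \<open>f' x v\<close>, which moves with
  \<open>x\<close>. Expanding this direction in the finite \<open>Basis\<close> leaves only fixed
  directions \<open>b\<close>, to which the induction hypothesis applies; the coefficients are
  smooth functions of \<open>x\<close>.\<close>

lemma Ck_on_compose:
  fixes f :: "'a::real_normed_vector \<Rightarrow> 'b::euclidean_space"
  assumes "open S" "open T" "f ` S \<subseteq> T" "Ck_on k S f" "Ck_on k T g"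
  shows "Ck_on k S (\<lambda>x. g (f x))"
  using assms(4,5)
proof (induction k arbitrary: g)
  case 0
  then show ?case
    using assms(3) by (auto intro: continuous_on_compose2)
next
  case (Suc k)
  define f' where "f' x = frechet_derivative f (at x)" for x
  define g' where "g' y = frechet_derivative g (at y)" for y
  have f': "(f has_derivative f' x) (at x)" if "x \<in> S" for x
    using Suc.prems(1) that by (simp add: f'_def frechet_derivative_works)
  have g': "(g has_derivative g' (f x)) (at (f x))" if "x \<in> S" for x
    using Suc.prems(2) assms(3) that by (auto simp: g'_def frechet_derivative_works image_subset_iff)
  show ?case
  proof (rule Ck_on_SucI[where f' = "\<lambda>x v. \<Sum>b\<in>Basis. (f' x v \<bullet> b) *\<^sub>R g' (f x) b"])
    fix x assume x: "x \<in> S"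
    interpret l: linear "g' (f x)"
      using g'[OF x] has_derivative_linear by blast
    have "g' (f x) (f' x v) = (\<Sum>b\<in>Basis. (f' x v \<bullet> b) *\<^sub>R g' (f x) b)" for v
      by (subst (1) euclidean_representation[of "f' x v", symmetric])
        (simp only: l.sum l.scaleR)
    then show "((\<lambda>x. g (f x)) has_derivative (\<lambda>v. \<Sum>b\<in>Basis. (f' x v \<bullet> b) *\<^sub>R g' (f x) b)) (at x)"
      using has_derivative_compose[OF f'[OF x] g'[OF x]] by simp
  next
    fix v
    show "Ck_on k S (\<lambda>x. \<Sum>b\<in>Basis. (f' x v \<bullet> b) *\<^sub>R g' (f x) b)"
      using Suc.prems
      by (intro Ck_on_sum Ck_on_bilinear[OF _ bounded_bilinear_scaleR]
          Ck_on_linear_comp[OF _ bounded_linear_inner_left] Suc.IH Ck_on_SucD[of k S f])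
        (auto simp: f'_def g'_def assms(1))
  qed (use assms(1) in auto)
qed

section \<open>Closure properties of smooth maps\<close>

lemma smooth_on_cong:
  assumes "open S" "smooth_on S f" "\<And>x. x \<in> S \<Longrightarrow> f x = g x"
  shows "smooth_on S g"
  using assms Ck_on_cong unfolding smooth_on_def by blast

lemma smooth_on_const: "smooth_on S (\<lambda>x. c)"
  unfolding smooth_on_def using Ck_on_const by blast

lemma smooth_on_linear: "open S \<Longrightarrow> bounded_linear f \<Longrightarrow> smooth_on S f"
  unfolding smooth_on_def using Ck_on_bounded_linear by blast

lemma smooth_on_linear_comp:
  "open S \<Longrightarrow> bounded_linear L \<Longrightarrow> smooth_on S f \<Longrightarrow> smooth_on S (\<lambda>x. L (f x))"
  unfolding smooth_on_def using Ck_on_linear_comp by blast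

lemma smooth_on_add:
  "open S \<Longrightarrow> smooth_on S f \<Longrightarrow> smooth_on S g \<Longrightarrow> smooth_on S (\<lambda>x. f x + g x)"
  unfolding smooth_on_def using Ck_on_add by blast

lemma smooth_on_diff:
  assumes "open S" "smooth_on S f" "smooth_on S g"
  shows "smooth_on S (\<lambda>x. f x - g x)"
  using smooth_on_add[OF assms(1,2)
      smooth_on_linear_comp[OF assms(1) bounded_linear_minus[OF bounded_linear_ident] assms(3)]]
  by simp

lemma smooth_on_sum:
  "open S \<Longrightarrow> (\<And>i. i \<in> I \<Longrightarrow> smooth_on S (f i)) \<Longrightarrow> smooth_on S (\<lambda>x. \<Sum>i\<in>I. f i x)"
  unfolding smooth_on_def by (auto intro: Ck_on_sum)

lemma smooth_on_bilinear:
  "open S \<Longrightarrow> bounded_bilinear B \<Longrightarrow> smooth_on S f \<Longrightarrow> smooth_on S g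
    \<Longrightarrow> smooth_on S (\<lambda>x. B (f x) (g x))"
  unfolding smooth_on_def using Ck_on_bilinear by blast

lemma smooth_on_compose:
  fixes f :: "'a::real_normed_vector \<Rightarrow> 'b::euclidean_space"
  assumes "open S" "open T" "f ` S \<subseteq> T" "smooth_on S f" "smooth_on T g"
  shows "smooth_on S (\<lambda>x. g (f x))"
  using assms Ck_on_compose unfolding smooth_on_def by blast

lemma smooth_on_Pair:
  assumes "open S" "smooth_on S f" "smooth_on S g"
  shows "smooth_on S (\<lambda>x. (f x, g x))"
proof -
  have "smooth_on S (\<lambda>x. (f x, 0) + (0, g x))"
    using assms
    by (intro smooth_on_add smooth_on_linear_comp[where L = "\<lambda>y. (y, 0)"]
        smooth_on_linear_comp[where L = "\<lambda>y. (0, y)"] bounded_linear_Pair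
        bounded_linear_ident bounded_linear_zero)
  then show ?thesis by simp
qed

lemma smooth_on_vec:
  fixes f :: "'a::real_normed_vector \<Rightarrow> 'n::finite \<Rightarrow> real"
  assumes "open S" "\<And>i. smooth_on S (\<lambda>x. f x i)"
  shows "smooth_on S (\<lambda>x. \<chi> i. f x i)"
proof -
  have "smooth_on S (\<lambda>x. \<Sum>i\<in>UNIV. f x i *\<^sub>R (axis i 1 :: real^'n))"
    using assms
    by (intro smooth_on_sum smooth_on_bilinear[OF _ bounded_bilinear_scaleR] smooth_on_const)
  moreover have "(\<Sum>i\<in>UNIV. f x i *\<^sub>R (axis i 1 :: real^'n)) = (\<chi> i. f x i)" for x
    by (simp add: vec_eq_iff axis_def if_distrib cong: if_cong)
  ultimately show ?thesis by simp
qed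

lemma smooth_on_frechet:
  "smooth_on S f \<Longrightarrow> smooth_on S (\<lambda>y. frechet_derivative f (at y) v)"
  unfolding smooth_on_def by (metis Ck_on.simps(2))

lemma smooth_on_has_derivative:
  "smooth_on S f \<Longrightarrow> y \<in> S \<Longrightarrow> (f has_derivative frechet_derivative f (at y)) (at y)"
  unfolding smooth_on_def by (metis Ck_on.simps(2) frechet_derivative_works)

lemma smooth_on_continuous: "smooth_on S f \<Longrightarrow> continuous_on S f"
  unfolding smooth_on_def by (metis Ck_on.simps(1))

section \<open>Frechet derivatives and Jacobian matrices\<close>

lemma frechet_derivative_cong:
  assumes "f differentiable (at x)" "open S" "x \<in> S" "\<And>y. y \<in> S \<Longrightarrow> f y = g y"
  shows "frechet_derivative f (at x) = frechet_derivative g (at x)"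
  using frechet_derivative_transform_within_open[OF assms] by simp

lemma jacobian_nth:
  "jacobian f net $ k $ i = frechet_derivative f net (axis i 1) $ k"
  by (simp add: jacobian_def matrix_def)

text \<open>This turns the fibre part of a bundle transition into inner products with derivatives in
  fixed directions, the form for which smoothness is available.\<close>

lemma vector_jacobian_nth:
  fixes w :: "real^'m"
  shows "(w v* jacobian f net) $ i = w \<bullet> frechet_derivative f net (axis i 1)"
  by (simp add: vector_matrix_mult_def jacobian_nth inner_vec_def mult.commute)

lemma jacobian_compose:
  fixes f :: "real^'n \<Rightarrow> real^'m" and g :: "real^'m \<Rightarrow> real^'k"
  assumes "f differentiable (at x)" "g differentiable (at (f x))"
  shows "jacobian (g \<circ> f) (at x) = jacobian g (at (f x)) ** jacobian f (at x)"
  unfolding jacobian_def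
  by (simp add: frechet_derivative_compose assms matrix_compose linear_frechet_derivative)


section \<open>Topologies generated by charts\<close>

text \<open>Data for gluing a space from charts on a bare set. It is instantiated with the total
  space of the bundle, whose points are equivalence classes.\<close>

locale chart_family =
  fixes D :: "'a \<Rightarrow> 'e set" and \<phi> :: "'a \<Rightarrow> 'e \<Rightarrow> 'v::euclidean_space"
  assumes inj: "inj_on (\<phi> \<alpha>) (D \<alpha>)"
    and open_overlap: "open (\<phi> \<alpha> ` (D \<alpha> \<inter> D \<beta>))"
    and cont: "continuous_on (\<phi> \<alpha> ` (D \<alpha> \<inter> D \<beta>)) (\<phi> \<beta> \<circ> inv_into (D \<alpha>) (\<phi> \<alpha>))"
begin

definition gen_top :: "'e topology" where
  "gen_top = topology_generated_by {{e \<in> D \<alpha>. \<phi> \<alpha> e \<in> W} | \<alpha> W. open W}"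

lemma openin_chart_preimage: "open W \<Longrightarrow> openin gen_top {e \<in> D \<alpha>. \<phi> \<alpha> e \<in> W}"
  unfolding gen_top_def by (rule topology_generated_by_Basis) blast

lemma topspace_gen_top: "topspace gen_top = (\<Union>\<alpha>. D \<alpha>)"
proof -
  have "D \<alpha> = {e \<in> D \<alpha>. \<phi> \<alpha> e \<in> UNIV}" for \<alpha> by simp
  then have "D \<alpha> \<in> {{e \<in> D \<alpha>. \<phi> \<alpha> e \<in> W} | \<alpha> W. open W}" for \<alpha>
    using open_UNIV by blast
  then show ?thesis
    unfolding gen_top_def topology_generated_by_topspace by blast
qed

lemma openin_dom: "openin gen_top (D \<alpha>)"
  using openin_chart_preimage[OF open_UNIV] by simp

text \<open>Induction over the generation of the topology. A generator from chart
  \<open>\<beta>\<close> is sent by chart \<open>\<alpha>\<close> to the preimage of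
  \<open>W\<close> under the transition map, which is open by \<open>cont\<close> and
  \<open>open_overlap\<close>; injectivity lets the image commute with intersections.\<close>

lemma open_chart_image:
  assumes "openin gen_top U"
  shows "open (\<phi> \<alpha> ` (U \<inter> D \<alpha>))"
  using openin_topology_generated_by[OF assms[unfolded gen_top_def]]
proof (induction rule: generate_topology_on.induct)
  case (Int a b)
  have "\<phi> \<alpha> ` (a \<inter> b \<inter> D \<alpha>) = \<phi> \<alpha> ` (a \<inter> D \<alpha>) \<inter> \<phi> \<alpha> ` (b \<inter> D \<alpha>)"
    using inj_on_image_Int[OF inj, of "a \<inter> D \<alpha>" \<alpha> "b \<inter> D \<alpha>"] by (simp add: Int_ac)
  then show ?case using Int by auto
next
  case (UN K)
  have "\<phi> \<alpha> ` (\<Union>K \<inter> D \<alpha>) = (\<Union>k\<in>K. \<phi> \<alpha> ` (k \<inter> D \<alpha>))" by blast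
  then show ?case using UN by auto
next
  case (Basis U)
  then obtain \<beta> W where U: "U = {e \<in> D \<beta>. \<phi> \<beta> e \<in> W}" and "open W" by blast
  have "\<phi> \<alpha> ` (U \<inter> D \<alpha>) = \<phi> \<alpha> ` (D \<alpha> \<inter> D \<beta>) \<inter> (\<phi> \<beta> \<circ> inv_into (D \<alpha>) (\<phi> \<alpha>)) -` W"
    by (auto simp: U inv_into_f_f[OF inj])
  then show ?case
    using continuous_open_preimage[OF cont open_overlap \<open>open W\<close>] by simp
qed simp

lemma homeomorphic_chart:
  "homeomorphic_map (subtopology gen_top (D \<alpha>)) (top_of_set (\<phi> \<alpha> ` D \<alpha>)) (\<phi> \<alpha>)"
proof (rule bijective_open_imp_homeomorphic_map)
  have ts: "topspace (subtopology gen_top (D \<alpha>)) = D \<alpha>"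
    by (auto simp: topspace_gen_top)
  show "continuous_map (subtopology gen_top (D \<alpha>)) (top_of_set (\<phi> \<alpha> ` D \<alpha>)) (\<phi> \<alpha>)"
    unfolding continuous_map_in_subtopology continuous_map_def ts
    by (auto simp: openin_subtopology_alt intro!: openin_chart_preimage image_eqI[where x = "{e \<in> D \<alpha>. \<phi> \<alpha> e \<in> _}"])
  show "open_map (subtopology gen_top (D \<alpha>)) (top_of_set (\<phi> \<alpha> ` D \<alpha>)) (\<phi> \<alpha>)"
    unfolding open_map_def
  proof (intro allI impI)
    fix U assume "openin (subtopology gen_top (D \<alpha>)) U"
    then obtain V where "openin gen_top V" "U = V \<inter> D \<alpha>" by (auto simp: openin_subtopology)
    then show "openin (top_of_set (\<phi> \<alpha> ` D \<alpha>)) (\<phi> \<alpha> ` U)"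
      using open_chart_image[of V \<alpha>] by (auto intro: open_subset)
  qed
qed (auto simp: topspace_gen_top inj Int_absorb1 SUP_upper)

lemma second_countable_gen_top:
  assumes "countable C" "(\<Union>\<alpha>\<in>C. D \<alpha>) = (\<Union>\<alpha>. D \<alpha>)"
  shows "second_countable gen_top"
proof -
  obtain B :: "'v set set" where B: "countable B" "topological_basis B"
    using ex_countable_basis by blast
  define BB where "BB = (\<lambda>(\<alpha>, b). {e \<in> D \<alpha>. \<phi> \<alpha> e \<in> b}) ` (C \<times> B)"
  have "countable BB"
    unfolding BB_def using assms(1) B(1) by auto
  moreover have "\<forall>V\<in>BB. openin gen_top V"
    unfolding BB_def using topological_basis_open[OF B(2)] openin_chart_preimage by auto
  moreover have "\<exists>V\<in>BB. x \<in> V \<and> V \<subseteq> U" if U: "openin gen_top U" "x \<in> U" for U x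
  proof -
    have "x \<in> (\<Union>\<alpha>. D \<alpha>)"
      using openin_subset[OF U(1)] U(2) topspace_gen_top by auto
    then obtain \<alpha> where \<alpha>: "\<alpha> \<in> C" "x \<in> D \<alpha>"
      unfolding assms(2)[symmetric] by blast
    \<comment> \<open>The basic set is chosen inside the coordinate image of \<open>U\<close>, so
      that injectivity of the chart forces its preimage back into \<open>U\<close>.\<close>
    obtain b where b: "b \<in> B" "\<phi> \<alpha> x \<in> b" "b \<subseteq> \<phi> \<alpha> ` (U \<inter> D \<alpha>)"
      using topological_basisE[OF B(2) open_chart_image[OF U(1), of \<alpha>], of "\<phi> \<alpha> x"] U(2) \<alpha>(2)
      by blast
    have "{e \<in> D \<alpha>. \<phi> \<alpha> e \<in> b} \<subseteq> U"
      using b(3) inj_onD[OF inj] by (smt (verit) IntD1 IntD2 imageE mem_Collect_eq subset_iff)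
    then show ?thesis
      unfolding BB_def using \<alpha> b by (intro bexI[of _ "{e \<in> D \<alpha>. \<phi> \<alpha> e \<in> b}"]) auto
  qed
  ultimately show ?thesis
    unfolding second_countable_def by blast
qed

end


section \<open>Coordinate changes of a smooth manifold\<close>

locale manifold =
  fixes M :: "('a, 'm, 'e::euclidean_space) atlas"
  assumes mfd: "smooth_manifold M"
begin

abbreviation change :: "'a \<Rightarrow> 'a \<Rightarrow> 'e \<Rightarrow> 'e" where
  "change \<alpha> \<beta> \<equiv> local_rep M \<alpha> M \<beta> (\<lambda>m. m)"

abbreviation overlap :: "'a \<Rightarrow> 'a \<Rightarrow> 'e set" where
  "overlap \<alpha> \<beta> \<equiv> chart M \<alpha> ` (chart_dom M \<alpha> \<inter> chart_dom M \<beta>)"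

lemma openin_chart_dom: "openin (pts M) (chart_dom M \<alpha>)"
  using mfd by (simp add: smooth_manifold_def)

lemma topspace_eq: "topspace (pts M) = (\<Union>\<alpha>. chart_dom M \<alpha>)"
  using mfd by (simp add: smooth_manifold_def)

lemma in_topspace: "m \<in> chart_dom M \<alpha> \<Longrightarrow> m \<in> topspace (pts M)"
  using topspace_eq by blast

lemma open_chart_img: "open (chart_img M \<alpha>)"
  using mfd by (simp add: smooth_manifold_def)

lemma homeo: "homeomorphic_map (subtopology (pts M) (chart_dom M \<alpha>))
    (top_of_set (chart_img M \<alpha>)) (chart M \<alpha>)"
  using mfd by (simp add: smooth_manifold_def)

lemma topspace_chart_dom: "topspace (subtopology (pts M) (chart_dom M \<alpha>)) = chart_dom M \<alpha>"
  using topspace_eq by auto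

lemma inj_chart: "inj_on (chart M \<alpha>) (chart_dom M \<alpha>)"
  using homeomorphic_imp_injective_map[OF homeo] topspace_chart_dom by simp

lemma chart_in [simp]: "m \<in> chart_dom M \<alpha> \<Longrightarrow> chart M \<alpha> m \<in> chart_img M \<alpha>"
  by (simp add: chart_img_def)

lemma chart_inv_chart [simp]: "m \<in> chart_dom M \<alpha> \<Longrightarrow> chart_inv M \<alpha> (chart M \<alpha> m) = m"
  by (simp add: chart_inv_def inv_into_f_f[OF inj_chart])

lemma chart_chart_inv [simp]: "y \<in> chart_img M \<alpha> \<Longrightarrow> chart M \<alpha> (chart_inv M \<alpha> y) = y"
  by (simp add: chart_inv_def chart_img_def f_inv_into_f)

lemma chart_inv_in [simp]: "y \<in> chart_img M \<alpha> \<Longrightarrow> chart_inv M \<alpha> y \<in> chart_dom M \<alpha>"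
  by (simp add: chart_inv_def chart_img_def inv_into_into)

lemma open_chart_image:
  assumes "openin (pts M) U"
  shows "open (chart M \<alpha> ` (chart_dom M \<alpha> \<inter> U))"
proof -
  have "openin (subtopology (pts M) (chart_dom M \<alpha>)) (chart_dom M \<alpha> \<inter> U)"
    using assms by (metis openin_subtopology inf_commute)
  then have "openin (top_of_set (chart_img M \<alpha>)) (chart M \<alpha> ` (chart_dom M \<alpha> \<inter> U))"
    using homeomorphic_imp_open_map[OF homeo] by (simp add: open_map_def)
  then show ?thesis
    using open_chart_img openin_open_trans by blast
qed

lemma openin_chart_preimage:
  assumes "open V"
  shows "openin (pts M) {m \<in> chart_dom M \<alpha>. chart M \<alpha> m \<in> V}"
proof -
  have "openin (top_of_set (chart_img M \<alpha>)) (chart_img M \<alpha> \<inter> V)"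
    using assms by (simp add: openin_open_Int)
  then have "openin (subtopology (pts M) (chart_dom M \<alpha>))
      {m \<in> chart_dom M \<alpha>. chart M \<alpha> m \<in> chart_img M \<alpha> \<inter> V}"
    using openin_continuous_map_preimage[OF homeomorphic_imp_continuous_map[OF homeo]]
      topspace_chart_dom by metis
  moreover have "{m \<in> chart_dom M \<alpha>. chart M \<alpha> m \<in> chart_img M \<alpha> \<inter> V}
      = {m \<in> chart_dom M \<alpha>. chart M \<alpha> m \<in> V}" by auto
  ultimately show ?thesis
    using openin_open_subtopology[OF openin_chart_dom] by simp
qed

lemma open_overlap: "open (overlap \<alpha> \<beta>)"
  using open_chart_image openin_chart_dom by blast

lemma smooth_change: "smooth_on (overlap \<alpha> \<beta>) (change \<alpha> \<beta>)"
  using mfd by (simp add: smooth_manifold_def)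

lemma change_chart [simp]: "m \<in> chart_dom M \<alpha> \<Longrightarrow> change \<alpha> \<beta> (chart M \<alpha> m) = chart M \<beta> m"
  by (simp add: local_rep_def)

lemma change_overlap: "change \<alpha> \<beta> ` overlap \<alpha> \<beta> \<subseteq> overlap \<beta> \<alpha>"
  by auto

lemma change_differentiable:
  "m \<in> chart_dom M \<alpha> \<Longrightarrow> m \<in> chart_dom M \<beta> \<Longrightarrow> change \<alpha> \<beta> differentiable (at (chart M \<alpha> m))"
  using smooth_on_has_derivative[OF smooth_change] differentiable_def by blast

text \<open>The index type of the charts may be uncountable; the Lindelof property extracts a
  countable subatlas, from which second countability of the bundle is obtained.\<close>

lemma countable_cover:
  obtains C where "countable C" "(\<Union>\<alpha>\<in>C. chart_dom M \<alpha>) = topspace (pts M)"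
proof -
  have "Lindelof_space (pts M)"
    using mfd second_countable_imp_Lindelof_space by (auto simp: smooth_manifold_def)
  then have "\<exists>\<V>. countable \<V> \<and> \<V> \<subseteq> range (chart_dom M) \<and> \<Union>\<V> = topspace (pts M)"
    by (rule Lindelof_spaceD) (auto simp: openin_chart_dom topspace_eq)
  then obtain \<V> where "countable \<V>" "\<V> \<subseteq> range (chart_dom M)" "\<Union>\<V> = topspace (pts M)"
    by (elim exE conjE)
  then show ?thesis
    using that countable_subset_image[of \<V> "chart_dom M" UNIV] by metis
qed

end


section \<open>The affine bundle as a smooth manifold\<close>

locale potential_manifold = manifold M
  for M :: "('a, 'm, real^'n) atlas" +
  fixes \<rho> :: "'a \<Rightarrow> real^'n \<Rightarrow> real^'n"
  assumes smooth_potential: "smooth_on (chart_img M \<alpha>) (\<rho> \<alpha>)"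
begin

text \<open>The map \<open>change \<alpha> \<alpha>\<close> is the identity only on the chart image,
  but this set is open and so determines the derivative.\<close>

lemma trans_jac_refl:
  assumes "m \<in> chart_dom M \<alpha>"
  shows "trans_jac M \<alpha> \<alpha> m = mat 1"
proof -
  have "frechet_derivative (\<lambda>x. x) (at (chart M \<alpha> m))
      = frechet_derivative (change \<alpha> \<alpha>) (at (chart M \<alpha> m))"
    by (rule frechet_derivative_cong[OF _ open_chart_img chart_in[OF assms]])
      (auto simp: local_rep_def)
  then show ?thesis
    by (simp add: trans_jac_def jacobian_def) (simp flip: matrix_id_mat_1 id_def)
qed

text \<open>The chain rule on the open triple overlap. It is the source of transitivity and, with
  \<open>\<gamma> = \<alpha>\<close>, of inverses in the bundle relation.\<close>

lemma trans_jac_cocycle: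
  assumes "m \<in> chart_dom M \<alpha>" "m \<in> chart_dom M \<beta>" "m \<in> chart_dom M \<gamma>"
  shows "trans_jac M \<alpha> \<gamma> m = trans_jac M \<beta> \<gamma> m ** trans_jac M \<alpha> \<beta> m"
proof -
  let ?O = "chart M \<alpha> ` (chart_dom M \<alpha> \<inter> (chart_dom M \<beta> \<inter> chart_dom M \<gamma>))"
  have "frechet_derivative (change \<alpha> \<gamma>) (at (chart M \<alpha> m))
      = frechet_derivative (change \<beta> \<gamma> \<circ> change \<alpha> \<beta>) (at (chart M \<alpha> m))"
  proof (rule frechet_derivative_cong[where S = ?O])
    show "open ?O"
      by (intro open_chart_image openin_Int openin_chart_dom)
  qed (use assms change_differentiable in auto)
  then have "trans_jac M \<alpha> \<gamma> m = jacobian (change \<beta> \<gamma> \<circ> change \<alpha> \<beta>) (at (chart M \<alpha> m))"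
    by (simp add: trans_jac_def jacobian_def)
  also have "\<dots> = trans_jac M \<beta> \<gamma> m ** trans_jac M \<alpha> \<beta> m"
    using assms by (subst jacobian_compose) (simp_all add: change_differentiable trans_jac_def)
  finally show ?thesis .
qed

lemma trans_jac_inverse:
  assumes "m \<in> chart_dom M \<alpha>" "m \<in> chart_dom M \<beta>"
  shows "trans_jac M \<alpha> \<beta> m ** trans_jac M \<beta> \<alpha> m = mat 1"
  using trans_jac_cocycle[of m \<beta> \<alpha> \<beta>] trans_jac_refl assms by simp

abbreviation pot :: "'a \<Rightarrow> 'm \<Rightarrow> real^'n" where
  "pot \<alpha> m \<equiv> \<rho> \<alpha> (chart M \<alpha> m)"

text \<open>The fibre coordinates relative to the potential, \<open>p - \<rho>\<close>, transform linearly.\<close>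

lemma bundle_rel_iff:
  "((\<alpha>, m, p), (\<beta>, m', q)) \<in> bundle_rel M \<rho> \<longleftrightarrow>
     m = m' \<and> m \<in> chart_dom M \<alpha> \<and> m \<in> chart_dom M \<beta> \<and>
     p - pot \<alpha> m = (q - pot \<beta> m) v* trans_jac M \<alpha> \<beta> m"
proof -
  have "(p $ i = (\<Sum>j\<in>UNIV. q $ j * trans_jac M \<alpha> \<beta> m $ j $ i) + potential_diff M \<rho> \<alpha> \<beta> m $ i)
      \<longleftrightarrow> (p - pot \<alpha> m) $ i = ((q - pot \<beta> m) v* trans_jac M \<alpha> \<beta> m) $ i" for i
    by (auto simp: potential_diff_def vector_matrix_mult_def algebra_simps sum_subtractf)
  then show ?thesis
    by (auto simp: bundle_rel_def vec_eq_iff)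
qed

lemma shift_iff:
  assumes "m \<in> chart_dom M \<alpha>" "m \<in> chart_dom M \<beta>"
  shows "v = w v* trans_jac M \<alpha> \<beta> m \<longleftrightarrow> w = v v* trans_jac M \<beta> \<alpha> m"
  using trans_jac_inverse assms
  by (metis vector_matrix_mul_assoc vector_matrix_mul_rid)

text \<open>After the shift by the potential, reflexivity, symmetry and transitivity are the
  identity, inverse and cocycle laws of the transition Jacobians.\<close>

lemma equiv_bundle_rel: "equiv {(\<alpha>, m, p). m \<in> chart_dom M \<alpha>} (bundle_rel M \<rho>)"
proof (rule equivI)
  show "bundle_rel M \<rho> \<subseteq> {(\<alpha>, m, p). m \<in> chart_dom M \<alpha>} \<times> {(\<alpha>, m, p). m \<in> chart_dom M \<alpha>}"
    by (auto simp: bundle_rel_iff)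
  show "refl_on {(\<alpha>, m, p). m \<in> chart_dom M \<alpha>} (bundle_rel M \<rho>)"
    by (auto simp: refl_on_def bundle_rel_iff trans_jac_refl)
  show "sym (bundle_rel M \<rho>)"
    unfolding sym_def split_paired_All bundle_rel_iff using shift_iff by blast
  show "trans (bundle_rel M \<rho>)"
    unfolding trans_def split_paired_All bundle_rel_iff
    by (metis trans_jac_cocycle vector_matrix_mul_assoc)
qed

text \<open>For \<open>m\<close> in the domain of \<open>\<alpha>\<close> this is the point with
  coordinates \<open>(chart M \<alpha> m, p)\<close>, so it serves as the inverse of the bundle
  chart; for other \<open>m\<close> the class is empty.\<close>

definition bpoint :: "'a \<Rightarrow> 'm \<Rightarrow> real^'n \<Rightarrow> ('a \<times> 'm \<times> (real^'n)) set" where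
  "bpoint \<alpha> m p = bundle_rel M \<rho> `` {(\<alpha>, m, p)}"

lemma in_bpoint_iff:
  "(\<beta>, m', q) \<in> bpoint \<alpha> m p \<longleftrightarrow>
    m' = m \<and> m \<in> chart_dom M \<alpha> \<and> m \<in> chart_dom M \<beta> \<and>
    q = pot \<beta> m + (p - pot \<alpha> m) v* trans_jac M \<beta> \<alpha> m"
  using shift_iff[of m \<alpha> \<beta> "p - pot \<alpha> m" "q - pot \<beta> m"]
  by (auto simp: bpoint_def bundle_rel_iff algebra_simps)

lemma bpoint_in_pts: "m \<in> chart_dom M \<alpha> \<Longrightarrow> bpoint \<alpha> m p \<in> bundle_pts M \<rho>"
  unfolding bpoint_def bundle_pts_def by (intro quotientI) simp

lemma bundle_ptsE:
  assumes "e \<in> bundle_pts M \<rho>"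
  obtains \<alpha> m p where "m \<in> chart_dom M \<alpha>" "e = bpoint \<alpha> m p"
  using assms unfolding bpoint_def bundle_pts_def by (auto elim: quotientE)

lemma bundle_proj_bpoint [simp]: "m \<in> chart_dom M \<alpha> \<Longrightarrow> bundle_proj (bpoint \<alpha> m p) = m"
  unfolding bundle_proj_def in_bpoint_iff by (rule the_equality) blast+

lemma fibre_coord_bpoint:
  "m \<in> chart_dom M \<alpha> \<Longrightarrow> m \<in> chart_dom M \<beta> \<Longrightarrow>
    fibre_coord \<beta> (bpoint \<alpha> m p) = pot \<beta> m + (p - pot \<alpha> m) v* trans_jac M \<beta> \<alpha> m"
  unfolding fibre_coord_def by (simp add: in_bpoint_iff)

lemma fibre_coord_bpoint_same [simp]:
  "m \<in> chart_dom M \<alpha> \<Longrightarrow> fibre_coord \<alpha> (bpoint \<alpha> m p) = p"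
  by (simp add: fibre_coord_bpoint trans_jac_refl)

lemma bpoint_change:
  assumes "m \<in> chart_dom M \<alpha>" "m \<in> chart_dom M \<beta>"
  shows "bpoint \<beta> m (pot \<beta> m + (p - pot \<alpha> m) v* trans_jac M \<beta> \<alpha> m) = bpoint \<alpha> m p"
proof -
  have "((\<alpha>, m, p), (\<beta>, m, pot \<beta> m + (p - pot \<alpha> m) v* trans_jac M \<beta> \<alpha> m)) \<in> bundle_rel M \<rho>"
    using in_bpoint_iff[of \<beta> m _ \<alpha> m p] assms by (simp add: bpoint_def)
  then show ?thesis
    unfolding bpoint_def using equiv_class_eq[OF equiv_bundle_rel] by blast
qed

lemma bundle_dom_iff:
  "e \<in> bundle_dom M \<rho> \<alpha> \<longleftrightarrow> (\<exists>m p. m \<in> chart_dom M \<alpha> \<and> e = bpoint \<alpha> m p)"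
proof
  assume e: "e \<in> bundle_dom M \<rho> \<alpha>"
  then obtain \<beta> m p where "m \<in> chart_dom M \<beta>" "e = bpoint \<beta> m p"
    unfolding bundle_dom_def by (auto elim: bundle_ptsE)
  then show "\<exists>m p. m \<in> chart_dom M \<alpha> \<and> e = bpoint \<alpha> m p"
    using e bpoint_change[of m \<beta> \<alpha> p] by (metis (no_types, lifting) bundle_dom_def bundle_proj_bpoint mem_Collect_eq)
qed (auto simp: bundle_dom_def bpoint_in_pts)

lemma bpoint_in_dom [simp]: "m \<in> chart_dom M \<alpha> \<Longrightarrow> bpoint \<alpha> m p \<in> bundle_dom M \<rho> \<alpha>"
  using bundle_dom_iff by blast

lemma bundle_pts_eq: "bundle_pts M \<rho> = (\<Union>\<alpha>. bundle_dom M \<rho> \<alpha>)"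
  using bundle_dom_iff by (auto simp: bundle_dom_def elim!: bundle_ptsE)

lemma bundle_chart_bpoint [simp]:
  "m \<in> chart_dom M \<alpha> \<Longrightarrow> bundle_chart M \<alpha> (bpoint \<alpha> m p) = (chart M \<alpha> m, p)"
  by (simp add: bundle_chart_def)

lemma bundle_proj_in: "e \<in> bundle_dom M \<rho> \<alpha> \<Longrightarrow> bundle_proj e \<in> chart_dom M \<alpha>"
  by (simp add: bundle_dom_def)

lemma inj_bundle_chart: "inj_on (bundle_chart M \<alpha>) (bundle_dom M \<rho> \<alpha>)"
  using inj_onD[OF inj_chart] by (fastforce simp: bundle_dom_iff inj_on_def)

lemma bundle_chart_image:
  assumes "U \<subseteq> chart_dom M \<alpha>"
  shows "bundle_chart M \<alpha> ` {e \<in> bundle_dom M \<rho> \<alpha>. bundle_proj e \<in> U} = chart M \<alpha> ` U \<times> UNIV"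
proof
  show "bundle_chart M \<alpha> ` {e \<in> bundle_dom M \<rho> \<alpha>. bundle_proj e \<in> U} \<subseteq> chart M \<alpha> ` U \<times> UNIV"
    by (auto simp: bundle_chart_def)
  show "chart M \<alpha> ` U \<times> UNIV \<subseteq> bundle_chart M \<alpha> ` {e \<in> bundle_dom M \<rho> \<alpha>. bundle_proj e \<in> U}"
  proof clarsimp
    fix m p assume "m \<in> U"
    then show "(chart M \<alpha> m, p) \<in> bundle_chart M \<alpha> ` {e \<in> bundle_dom M \<rho> \<alpha>. bundle_proj e \<in> U}"
      using assms by (intro image_eqI[where x = "bpoint \<alpha> m p"]) (auto simp: bundle_dom_iff)
  qed
qed

lemma bundle_chart_overlap:
  "bundle_chart M \<alpha> ` (bundle_dom M \<rho> \<alpha> \<inter> bundle_dom M \<rho> \<beta>) = overlap \<alpha> \<beta> \<times> UNIV"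
proof -
  have "bundle_dom M \<rho> \<alpha> \<inter> bundle_dom M \<rho> \<beta>
      = {e \<in> bundle_dom M \<rho> \<alpha>. bundle_proj e \<in> chart_dom M \<alpha> \<inter> chart_dom M \<beta>}"
    by (auto simp: bundle_dom_def)
  then show ?thesis
    using bundle_chart_image[of "chart_dom M \<alpha> \<inter> chart_dom M \<beta>" \<alpha>] by simp
qed

lemma bundle_chart_dom: "bundle_chart M \<alpha> ` bundle_dom M \<rho> \<alpha> = chart_img M \<alpha> \<times> UNIV"
  using bundle_chart_overlap[of \<alpha> \<alpha>] by (simp add: chart_img_def)

lemma inv_bundle_chart:
  assumes "x \<in> chart_img M \<alpha>"
  shows "inv_into (bundle_dom M \<rho> \<alpha>) (bundle_chart M \<alpha>) (x, p) = bpoint \<alpha> (chart_inv M \<alpha> x) p"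
  using assms by (intro inv_into_f_eq inj_bundle_chart) simp_all

text \<open>The transition map written in coordinates, so that closure rules for smooth maps apply
  to it. Covectors transform by the inverse coordinate change; hence the Jacobian of
  \<open>change \<beta> \<alpha>\<close>, taken at the \<open>\<beta>\<close>-coordinates.\<close>

definition bundle_change :: "'a \<Rightarrow> 'a \<Rightarrow> (real^'n) \<times> (real^'n) \<Rightarrow> (real^'n) \<times> (real^'n)" where
  "bundle_change \<alpha> \<beta> = (\<lambda>y. (change \<alpha> \<beta> (fst y), \<rho> \<beta> (change \<alpha> \<beta> (fst y))
     + (snd y - \<rho> \<alpha> (fst y)) v* jacobian (change \<beta> \<alpha>) (at (change \<alpha> \<beta> (fst y)))))"

lemma bundle_change_eq:
  assumes "y \<in> overlap \<alpha> \<beta> \<times> UNIV"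
  shows "bundle_change \<alpha> \<beta> y
      = (bundle_chart M \<beta> \<circ> inv_into (bundle_dom M \<rho> \<alpha>) (bundle_chart M \<alpha>)) y"
  using assms
  by (auto simp: bundle_change_def inv_bundle_chart bundle_chart_def fibre_coord_bpoint trans_jac_def)

lemma smooth_bundle_change: "smooth_on (overlap \<alpha> \<beta> \<times> UNIV) (bundle_change \<alpha> \<beta>)"
proof -
  let ?S = "overlap \<alpha> \<beta> \<times> (UNIV :: (real^'n) set)"
  have S: "open ?S"
    by (intro open_Times open_overlap open_UNIV)
  have f: "smooth_on ?S fst" and s: "smooth_on ?S snd"
    using smooth_on_linear[OF S] bounded_linear_fst bounded_linear_snd by blast+
  have c: "smooth_on ?S (\<lambda>y. change \<alpha> \<beta> (fst y))"
    by (rule smooth_on_compose[OF S open_overlap _ f smooth_change]) auto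
  have *: "(\<lambda>y. change \<alpha> \<beta> (fst y)) ` ?S \<subseteq> overlap \<beta> \<alpha>"
    using change_overlap by auto
  have p\<alpha>: "smooth_on ?S (\<lambda>y. \<rho> \<alpha> (fst y))"
    by (rule smooth_on_compose[OF S open_chart_img _ f smooth_potential]) auto
  have p\<beta>: "smooth_on ?S (\<lambda>y. \<rho> \<beta> (change \<alpha> \<beta> (fst y)))"
    by (rule smooth_on_compose[OF S open_chart_img _ c smooth_potential]) auto
  \<comment> \<open>The derivative in a fixed direction is smooth on the opposite overlap and is
    evaluated along the smooth map \<open>change \<alpha> \<beta>\<close>.\<close>
  have d: "smooth_on ?S (\<lambda>y. frechet_derivative (change \<beta> \<alpha>) (at (change \<alpha> \<beta> (fst y))) v)" for v
    by (rule smooth_on_compose[OF S open_overlap * c smooth_on_frechet[OF smooth_change]])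
  have "smooth_on ?S (\<lambda>y. \<chi> i. (snd y - \<rho> \<alpha> (fst y)) \<bullet>
      frechet_derivative (change \<beta> \<alpha>) (at (change \<alpha> \<beta> (fst y))) (axis i 1))"
    by (intro smooth_on_vec smooth_on_bilinear[OF S bounded_bilinear_inner] smooth_on_diff S s p\<alpha> d)
  moreover have "w v* jacobian (change \<beta> \<alpha>) net
      = (\<chi> i. w \<bullet> frechet_derivative (change \<beta> \<alpha>) net (axis i 1))" for w net
    by (simp add: vec_eq_iff vector_jacobian_nth)
  ultimately have "smooth_on ?S (\<lambda>y. (snd y - \<rho> \<alpha> (fst y)) v*
      jacobian (change \<beta> \<alpha>) (at (change \<alpha> \<beta> (fst y))))"
    by simp
  then show ?thesis
    unfolding bundle_change_def by (intro smooth_on_Pair smooth_on_add S c p\<beta>)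
qed

sublocale total: chart_family "bundle_dom M \<rho>" "bundle_chart M"
proof
  fix \<alpha> \<beta>
  show "inj_on (bundle_chart M \<alpha>) (bundle_dom M \<rho> \<alpha>)"
    by (rule inj_bundle_chart)
  show "open (bundle_chart M \<alpha> ` (bundle_dom M \<rho> \<alpha> \<inter> bundle_dom M \<rho> \<beta>))"
    unfolding bundle_chart_overlap by (intro open_Times open_overlap open_UNIV)
  show "continuous_on (bundle_chart M \<alpha> ` (bundle_dom M \<rho> \<alpha> \<inter> bundle_dom M \<rho> \<beta>))
      (bundle_chart M \<beta> \<circ> inv_into (bundle_dom M \<rho> \<alpha>) (bundle_chart M \<alpha>))"
    unfolding bundle_chart_overlap
    by (rule continuous_on_eq[OF smooth_on_continuous[OF smooth_bundle_change] bundle_change_eq])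
qed

section \<open>The manifold axioms for the total space\<close>

lemma affine_bundle_sel [simp]:
  "pts (affine_bundle M \<rho>) = total.gen_top"
  "chart_dom (affine_bundle M \<rho>) = bundle_dom M \<rho>"
  "chart (affine_bundle M \<rho>) = bundle_chart M"
  by (simp_all add: affine_bundle_def total.gen_top_def)

lemma topspace_bundle: "topspace total.gen_top = bundle_pts M \<rho>"
  by (simp add: total.topspace_gen_top bundle_pts_eq)

text \<open>In each bundle chart the preimage is the product of an open coordinate set with the
  whole fibre.\<close>

lemma openin_bundle_proj:
  assumes "openin (pts M) U"
  shows "openin total.gen_top {e \<in> bundle_pts M \<rho>. bundle_proj e \<in> U}"
proof -
  have *: "chart M \<alpha> m \<in> chart M \<alpha> ` (chart_dom M \<alpha> \<inter> U) \<longleftrightarrow> m \<in> U" if "m \<in> chart_dom M \<alpha>" for m \<alpha>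
    using inj_on_image_mem_iff[OF inj_chart that, of "chart_dom M \<alpha> \<inter> U"] that by blast
  have "{e \<in> bundle_pts M \<rho>. bundle_proj e \<in> U} = (\<Union>\<alpha>. {e \<in> bundle_dom M \<rho> \<alpha>. bundle_proj e \<in> U})"
    by (auto simp: bundle_pts_eq)
  also have "\<dots> = (\<Union>\<alpha>. {e \<in> bundle_dom M \<rho> \<alpha>.
      bundle_chart M \<alpha> e \<in> chart M \<alpha> ` (chart_dom M \<alpha> \<inter> U) \<times> UNIV})"
    using * bundle_proj_in by (intro SUP_cong Collect_cong) (auto simp: bundle_chart_def)
  finally show ?thesis
    by (auto intro!: openin_Union total.openin_chart_preimage open_Times open_chart_image assms)
qed

text \<open>Gluing need not preserve separation. Two points over the same base point lie in a common
  chart, because chart domains are full preimages under the projection, and are separated by their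
  coordinates. Points over different base points are separated by preimages of disjoint open sets of
  \<open>M\<close>.\<close>

lemma Hausdorff_bundle: "Hausdorff_space total.gen_top"
  unfolding Hausdorff_space_def topspace_bundle
proof (intro allI impI, elim conjE)
  fix e e' assume e: "e \<in> bundle_pts M \<rho>" "e' \<in> bundle_pts M \<rho>" "e \<noteq> e'"
  show "\<exists>U V. openin total.gen_top U \<and> openin total.gen_top V \<and> e \<in> U \<and> e' \<in> V \<and> disjnt U V"
  proof (cases "bundle_proj e = bundle_proj e'")
    case True
    obtain \<alpha> where \<alpha>: "e \<in> bundle_dom M \<rho> \<alpha>"
      using e(1) bundle_pts_eq by blast
    then have \<alpha>': "e' \<in> bundle_dom M \<rho> \<alpha>"
      using e(2) True by (simp add: bundle_dom_def)
    have "bundle_chart M \<alpha> e \<noteq> bundle_chart M \<alpha> e'"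
      using inj_onD[OF inj_bundle_chart _ \<alpha> \<alpha>'] e(3) by blast
    then obtain U V where UV: "open U" "open V" "bundle_chart M \<alpha> e \<in> U" "bundle_chart M \<alpha> e' \<in> V" "U \<inter> V = {}"
      using hausdorff by metis
    show ?thesis
      by (rule exI[of _ "{e \<in> bundle_dom M \<rho> \<alpha>. bundle_chart M \<alpha> e \<in> U}"],
          rule exI[of _ "{e \<in> bundle_dom M \<rho> \<alpha>. bundle_chart M \<alpha> e \<in> V}"])
        (use UV \<alpha> \<alpha>' in \<open>auto simp: disjnt_def intro!: total.openin_chart_preimage\<close>)
  next
    case False
    have "bundle_proj e \<in> topspace (pts M)" "bundle_proj e' \<in> topspace (pts M)"
      using e in_topspace bundle_proj_in by (metis bundle_pts_eq UN_E)+
    then obtain U V where UV: "openin (pts M) U" "openin (pts M) V" "bundle_proj e \<in> U"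
        "bundle_proj e' \<in> V" "disjnt U V"
      using mfd False unfolding smooth_manifold_def Hausdorff_space_def by metis
    show ?thesis
      by (rule exI[of _ "{e \<in> bundle_pts M \<rho>. bundle_proj e \<in> U}"],
          rule exI[of _ "{e \<in> bundle_pts M \<rho>. bundle_proj e \<in> V}"])
        (use UV e in \<open>auto simp: disjnt_def intro!: openin_bundle_proj\<close>)
  qed
qed

text \<open>Bundle chart domains are full preimages of chart domains, so a countable subcover of the
  base covers the bundle as well.\<close>

lemma second_countable_bundle: "second_countable total.gen_top"
proof -
  obtain C where C: "countable C" "(\<Union>\<alpha>\<in>C. chart_dom M \<alpha>) = topspace (pts M)"
    by (rule countable_cover)
  have "(\<Union>\<alpha>\<in>A. bundle_dom M \<rho> \<alpha>) = {e \<in> bundle_pts M \<rho>. bundle_proj e \<in> (\<Union>\<alpha>\<in>A. chart_dom M \<alpha>)}"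
    for A by (auto simp: bundle_dom_def)
  then have "(\<Union>\<alpha>\<in>C. bundle_dom M \<rho> \<alpha>) = (\<Union>\<alpha>. bundle_dom M \<rho> \<alpha>)"
    by (simp only: C(2) topspace_eq)
  with C(1) show ?thesis
    by (rule total.second_countable_gen_top)
qed

lemma smooth_manifold_bundle: "smooth_manifold (affine_bundle M \<rho>)"
  unfolding smooth_manifold_def
proof (intro conjI allI)
  fix \<alpha> \<beta>
  let ?E = "affine_bundle M \<rho>"
  have img: "chart_img ?E \<alpha> = bundle_chart M \<alpha> ` bundle_dom M \<rho> \<alpha>"
    by (simp add: chart_img_def)
  show "open (chart_img ?E \<alpha>)"
    unfolding img bundle_chart_dom by (intro open_Times open_chart_img open_UNIV)
  show "homeomorphic_map (subtopology (pts ?E) (chart_dom ?E \<alpha>))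
      (top_of_set (chart_img ?E \<alpha>)) (chart ?E \<alpha>)"
    unfolding img using total.homeomorphic_chart by simp
  have lr: "local_rep ?E \<alpha> ?E \<beta> (\<lambda>m. m)
      = bundle_chart M \<beta> \<circ> inv_into (bundle_dom M \<rho> \<alpha>) (bundle_chart M \<alpha>)"
    by (auto simp: local_rep_def chart_inv_def)
  show "smooth_on (chart ?E \<alpha> ` (chart_dom ?E \<alpha> \<inter> chart_dom ?E \<beta>)) (local_rep ?E \<alpha> ?E \<beta> (\<lambda>m. m))"
    unfolding lr affine_bundle_sel bundle_chart_overlap
    by (rule smooth_on_cong[OF _ smooth_bundle_change bundle_change_eq])
      (intro open_Times open_overlap open_UNIV)
qed (simp_all add: Hausdorff_bundle second_countable_bundle total.topspace_gen_top total.openin_dom)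

lemma bundle_chart_inv:
  "x \<in> chart_img M \<alpha> \<Longrightarrow> chart_inv (affine_bundle M \<rho>) \<alpha> (x, p) = bpoint \<alpha> (chart_inv M \<alpha> x) p"
  by (simp add: chart_inv_def inv_bundle_chart)

lemma bundle_chart_img: "chart_img (affine_bundle M \<rho>) \<alpha> = chart_img M \<alpha> \<times> UNIV"
  by (simp add: chart_img_def bundle_chart_dom[unfolded chart_img_def])

lemma smooth_bundle_proj: "smooth_map (affine_bundle M \<rho>) M bundle_proj"
  unfolding smooth_map_def
proof (intro conjI allI)
  have "bundle_proj e \<in> topspace (pts M)" if "e \<in> bundle_pts M \<rho>" for e
    using that in_topspace bundle_proj_in by (metis bundle_pts_eq UN_E)
  then show "continuous_map (pts (affine_bundle M \<rho>)) (pts M) bundle_proj"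
    by (auto simp: continuous_map_def topspace_bundle openin_bundle_proj)
  fix \<alpha> \<beta>
  have *: "chart (affine_bundle M \<rho>) \<alpha> `
      {e \<in> chart_dom (affine_bundle M \<rho>) \<alpha>. bundle_proj e \<in> chart_dom M \<beta>} = overlap \<alpha> \<beta> \<times> UNIV"
    by (auto simp flip: bundle_chart_overlap simp: bundle_dom_def)
  let ?S = "overlap \<alpha> \<beta> \<times> (UNIV :: (real^'n) set)"
  have S: "open ?S"
    by (intro open_Times open_overlap open_UNIV)
  have "smooth_on ?S (\<lambda>y. change \<alpha> \<beta> (fst y))"
    by (rule smooth_on_compose[OF S open_overlap _ smooth_on_linear[OF S bounded_linear_fst]
          smooth_change]) auto
  then show "smooth_on (chart (affine_bundle M \<rho>) \<alpha> `
      {e \<in> chart_dom (affine_bundle M \<rho>) \<alpha>. bundle_proj e \<in> chart_dom M \<beta>})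
      (local_rep (affine_bundle M \<rho>) \<alpha> M \<beta> bundle_proj)"
    unfolding * by (rule smooth_on_cong[OF S]) (auto simp: local_rep_def bundle_chart_inv)
qed

end


section \<open>The constraint surface\<close>

context potential_manifold
begin

lemma constraint_bpoint [simp]:
  "m \<in> chart_dom M \<alpha> \<Longrightarrow> constraint M \<rho> \<alpha> i (bpoint \<alpha> m p) = pot \<alpha> m $ i - p $ i"
  by (simp add: constraint_def)

lemma bpoint_pot_change:
  "m \<in> chart_dom M \<alpha> \<Longrightarrow> m \<in> chart_dom M \<beta> \<Longrightarrow> bpoint \<alpha> m (pot \<alpha> m) = bpoint \<beta> m (pot \<beta> m)"
  using bpoint_change[of m \<beta> \<alpha> "pot \<beta> m"] by simp

text \<open>The definition demands vanishing constraints in every chart around the point. One chart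
  suffices, because \<open>p - \<rho>\<close> transforms linearly and so zero goes to zero.\<close>

lemma constraint_surface_iff:
  "e \<in> constraint_surface M \<rho> \<longleftrightarrow> (\<exists>\<alpha> m. m \<in> chart_dom M \<alpha> \<and> e = bpoint \<alpha> m (pot \<alpha> m))"
proof
  assume e: "e \<in> constraint_surface M \<rho>"
  then obtain \<alpha> m p where m: "m \<in> chart_dom M \<alpha>" "e = bpoint \<alpha> m p"
    by (auto simp: constraint_surface_def elim: bundle_ptsE)
  then have "e \<in> bundle_dom M \<rho> \<alpha>"
    by simp
  then have "constraint M \<rho> \<alpha> i e = 0" for i
    using e by (simp add: constraint_surface_def)
  then have "p = pot \<alpha> m"
    using m by (simp add: vec_eq_iff)
  then show "\<exists>\<alpha> m. m \<in> chart_dom M \<alpha> \<and> e = bpoint \<alpha> m (pot \<alpha> m)"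
    using m by blast
next
  assume "\<exists>\<alpha> m. m \<in> chart_dom M \<alpha> \<and> e = bpoint \<alpha> m (pot \<alpha> m)"
  then obtain \<alpha> m where m: "m \<in> chart_dom M \<alpha>" "e = bpoint \<alpha> m (pot \<alpha> m)" by blast
  have "constraint M \<rho> \<beta> i e = 0" if "e \<in> bundle_dom M \<rho> \<beta>" for \<beta> i
  proof -
    have "m \<in> chart_dom M \<beta>"
      using bundle_proj_in[OF that] m by simp
    then show ?thesis
      using m bpoint_pot_change[of m \<alpha> \<beta>] by simp
  qed
  then show "e \<in> constraint_surface M \<rho>"
    using m bpoint_in_pts by (auto simp: constraint_surface_def)
qed

lemma surface_section_eq:
  assumes "m \<in> chart_dom M \<alpha>"
  shows "surface_section M \<rho> m = bpoint \<alpha> m (pot \<alpha> m)"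
  unfolding surface_section_def
proof (rule the_equality)
  show "bpoint \<alpha> m (pot \<alpha> m) \<in> constraint_surface M \<rho> \<and> bundle_proj (bpoint \<alpha> m (pot \<alpha> m)) = m"
    using assms constraint_surface_iff by auto
next
  fix e assume "e \<in> constraint_surface M \<rho> \<and> bundle_proj e = m"
  then obtain \<beta> where "m \<in> chart_dom M \<beta>" "e = bpoint \<beta> m (pot \<beta> m)"
    by (auto simp: constraint_surface_iff)
  then show "e = bpoint \<alpha> m (pot \<alpha> m)"
    using bpoint_pot_change assms by blast
qed

lemma section_in_surface: "m \<in> topspace (pts M) \<Longrightarrow> surface_section M \<rho> m \<in> constraint_surface M \<rho>"
  using surface_section_eq unfolding topspace_eq constraint_surface_iff by blast

lemma bundle_proj_section [simp]:
  "m \<in> topspace (pts M) \<Longrightarrow> bundle_proj (surface_section M \<rho> m) = m"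
  using surface_section_eq by (auto simp: topspace_eq)

lemma section_bundle_proj [simp]:
  "e \<in> constraint_surface M \<rho> \<Longrightarrow> surface_section M \<rho> (bundle_proj e) = e"
  using surface_section_eq by (auto simp: constraint_surface_iff)

lemma section_in_dom_iff:
  "m \<in> topspace (pts M) \<Longrightarrow> surface_section M \<rho> m \<in> bundle_dom M \<rho> \<alpha> \<longleftrightarrow> m \<in> chart_dom M \<alpha>"
  using section_in_surface[of m] by (auto simp: bundle_dom_def constraint_surface_def)

lemma bundle_chart_section:
  "m \<in> chart_dom M \<alpha> \<Longrightarrow> bundle_chart M \<alpha> (surface_section M \<rho> m) = (chart M \<alpha> m, pot \<alpha> m)"
  by (simp add: surface_section_eq)

lemma constraint_surface_subset: "constraint_surface M \<rho> \<subseteq> bundle_pts M \<rho>"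
  by (auto simp: constraint_surface_def)

lemma bundle_proj_surface: "e \<in> constraint_surface M \<rho> \<Longrightarrow> bundle_proj e \<in> topspace (pts M)"
  using in_topspace by (auto simp: constraint_surface_iff)

lemma section_image: "surface_section M \<rho> ` topspace (pts M) = constraint_surface M \<rho>"
proof
  show "constraint_surface M \<rho> \<subseteq> surface_section M \<rho> ` topspace (pts M)"
    using section_bundle_proj bundle_proj_surface by (metis imageI subsetI)
qed (auto simp: section_in_surface)

section \<open>Smoothness of the section and straightening of the surface\<close>

lemma smooth_graph: "smooth_on (chart_img M \<alpha>) (\<lambda>x. (x, \<rho> \<alpha> x))"
  by (intro smooth_on_Pair open_chart_img smooth_potential smooth_on_linear bounded_linear_ident)

text \<open>Only generators of the bundle topology have to be tested, and in the chart that defines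
  the generator the section is the graph of \<open>\<rho> \<alpha>\<close>.\<close>

lemma continuous_section: "continuous_map (pts M) total.gen_top (surface_section M \<rho>)"
  unfolding total.gen_top_def continuous_on_generated_topo_iff
proof (intro conjI allI impI)
  fix U assume "U \<in> {{e \<in> bundle_dom M \<rho> \<alpha>. bundle_chart M \<alpha> e \<in> W} | \<alpha> W. open W}"
  then obtain \<alpha> W where U: "U = {e \<in> bundle_dom M \<rho> \<alpha>. bundle_chart M \<alpha> e \<in> W}" and W: "open W"
    by blast
  let ?V = "chart_img M \<alpha> \<inter> (\<lambda>x. (x, \<rho> \<alpha> x)) -` W"
  have "open ?V"
    by (rule continuous_open_preimage[OF smooth_on_continuous[OF smooth_graph] open_chart_img W])
  moreover have "surface_section M \<rho> -` U \<inter> topspace (pts M) = {m \<in> chart_dom M \<alpha>. chart M \<alpha> m \<in> ?V}"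
    by (auto simp: U section_in_dom_iff bundle_chart_section in_topspace)
  ultimately show "openin (pts M) (surface_section M \<rho> -` U \<inter> topspace (pts M))"
    using openin_chart_preimage[of ?V \<alpha>] by (simp only:)
next
  show "surface_section M \<rho> ` topspace (pts M)
      \<subseteq> \<Union>{{e \<in> bundle_dom M \<rho> \<alpha>. bundle_chart M \<alpha> e \<in> W} | \<alpha> W. open W}"
    using section_image constraint_surface_subset topspace_bundle
    unfolding total.gen_top_def topology_generated_by_topspace by simp
qed

lemma smooth_section_surface: "smooth_section M \<rho> (surface_section M \<rho>)"
  unfolding smooth_section_def smooth_map_def
proof (intro conjI allI ballI)
  show "continuous_map (pts M) (pts (affine_bundle M \<rho>)) (surface_section M \<rho>)"
    using continuous_section by simp
  fix \<alpha> \<beta>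
  have *: "{m \<in> chart_dom M \<alpha>. surface_section M \<rho> m \<in> chart_dom (affine_bundle M \<rho>) \<beta>}
      = chart_dom M \<alpha> \<inter> chart_dom M \<beta>"
    by (auto simp: section_in_dom_iff in_topspace)
  have "smooth_on (overlap \<alpha> \<beta>) (\<lambda>x. (change \<alpha> \<beta> x, \<rho> \<beta> (change \<alpha> \<beta> x)))"
    by (rule smooth_on_compose[OF open_overlap open_chart_img _ smooth_change smooth_graph]) auto
  then show "smooth_on (chart M \<alpha> `
      {m \<in> chart_dom M \<alpha>. surface_section M \<rho> m \<in> chart_dom (affine_bundle M \<rho>) \<beta>})
      (local_rep M \<alpha> (affine_bundle M \<rho>) \<beta> (surface_section M \<rho>))"
    unfolding *
    by (rule smooth_on_cong[OF open_overlap]) (auto simp: local_rep_def bundle_chart_section)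
qed simp

lemma bundle_chart_surface:
  "bundle_chart M \<alpha> ` (constraint_surface M \<rho> \<inter> bundle_dom M \<rho> \<alpha>) = (\<lambda>x. (x, \<rho> \<alpha> x)) ` chart_img M \<alpha>"
proof -
  have "constraint_surface M \<rho> \<inter> bundle_dom M \<rho> \<alpha> = surface_section M \<rho> ` chart_dom M \<alpha>"
    unfolding section_image[symmetric] using in_topspace by (auto simp: section_in_dom_iff)
  then show ?thesis
    by (auto simp: chart_img_def bundle_chart_section image_iff)
qed

text \<open>The shear \<open>(x, p) \<mapsto> (x, p - \<rho>(x))\<close> is a diffeomorphism of the
  whole chart image onto itself and takes the graph of the potential to the plane of vanishing fibre
  coordinate, so one straightening serves all points of a chart.\<close>

lemma embedded_constraint_surface:
  "embedded_submanifold CARD('n) (affine_bundle M \<rho>) (constraint_surface M \<rho>)"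
  unfolding embedded_submanifold_def
proof (intro conjI ballI)
  show "constraint_surface M \<rho> \<subseteq> topspace (pts (affine_bundle M \<rho>))"
    using constraint_surface_subset topspace_bundle by simp
  fix e assume e: "e \<in> constraint_surface M \<rho>"
  then obtain \<alpha> where \<alpha>: "e \<in> bundle_dom M \<rho> \<alpha>"
    using constraint_surface_subset bundle_pts_eq by blast
  let ?W = "chart_img M \<alpha> \<times> (UNIV :: (real^'n) set)"
  let ?\<Psi> = "\<lambda>y. (fst y, snd y - \<rho> \<alpha> (fst y))"
  let ?\<Phi> = "\<lambda>y. (fst y, snd y + \<rho> \<alpha> (fst y))"
  let ?T = "(UNIV :: (real^'n) set) \<times> {0 :: real^'n}"
  have W: "open ?W"
    by (intro open_Times open_chart_img open_UNIV)
  have im: "?\<Psi> ` ?W = ?W"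
  proof
    show "?W \<subseteq> ?\<Psi> ` ?W"
    proof
      fix y assume "y \<in> ?W"
      then show "y \<in> ?\<Psi> ` ?W" by (intro image_eqI[of _ _ "?\<Phi> y"]) auto
    qed
  qed auto
  have inj: "inj_on ?\<Psi> ?W"
    by (auto simp: inj_on_def)
  have f: "smooth_on ?W fst" and s: "smooth_on ?W snd"
    using smooth_on_linear[OF W] bounded_linear_fst bounded_linear_snd by blast+
  have r: "smooth_on ?W (\<lambda>y. \<rho> \<alpha> (fst y))"
    by (rule smooth_on_compose[OF W open_chart_img _ f smooth_potential]) auto
  have "smooth_on ?W ?\<Psi>" "smooth_on ?W ?\<Phi>"
    by (intro smooth_on_Pair smooth_on_diff smooth_on_add W f s r)+
  \<comment> \<open>The inverse shear and \<open>inv_into\<close> agree on \<open>?W\<close>, which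
    is also the image of \<open>?\<Psi>\<close>; this open set suffices to carry smoothness
    over.\<close>
  moreover have "?\<Phi> y = inv_into ?W ?\<Psi> y" if "y \<in> ?W" for y
    using that by (intro inv_into_f_eq[OF inj, symmetric]) auto
  ultimately have "smooth_on ?W ?\<Psi>" "smooth_on (?\<Psi> ` ?W) (inv_into ?W ?\<Psi>)"
    unfolding im using smooth_on_cong[OF W] by blast+
  moreover have "subspace ?T" "dim ?T = CARD('n)"
    by (auto simp: subspace_Times dim_Times)
  moreover have "?\<Psi> ` (?W \<inter> (\<lambda>x. (x, \<rho> \<alpha> x)) ` chart_img M \<alpha>) = ?W \<inter> ?T"
  proof
    show "?W \<inter> ?T \<subseteq> ?\<Psi> ` (?W \<inter> (\<lambda>x. (x, \<rho> \<alpha> x)) ` chart_img M \<alpha>)"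
    proof
      fix y assume "y \<in> ?W \<inter> ?T"
      then show "y \<in> ?\<Psi> ` (?W \<inter> (\<lambda>x. (x, \<rho> \<alpha> x)) ` chart_img M \<alpha>)"
        by (intro image_eqI[of _ _ "?\<Phi> y"]) auto
    qed
  qed auto
  moreover have "bundle_chart M \<alpha> e \<in> ?W"
    using \<alpha> bundle_chart_dom by blast
  ultimately show "\<exists>\<alpha> W (\<Psi> :: (real^'n) \<times> (real^'n) \<Rightarrow> (real^'n) \<times> (real^'n)) T. e \<in> chart_dom (affine_bundle M \<rho>) \<alpha> \<and> open W \<and>
      chart (affine_bundle M \<rho>) \<alpha> e \<in> W \<and> W \<subseteq> chart_img (affine_bundle M \<rho>) \<alpha> \<and>
      open (\<Psi> ` W) \<and> inj_on \<Psi> W \<and> smooth_on W \<Psi> \<and> smooth_on (\<Psi> ` W) (inv_into W \<Psi>) \<and>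
      subspace T \<and> dim T = CARD('n) \<and>
      \<Psi> ` (W \<inter> chart (affine_bundle M \<rho>) \<alpha> `
        (constraint_surface M \<rho> \<inter> chart_dom (affine_bundle M \<rho>) \<alpha>)) = \<Psi> ` W \<inter> T"
    using \<alpha> W inj im bundle_chart_surface[of \<alpha>] bundle_chart_img[of \<alpha>]
    by (intro exI[of _ \<alpha>] exI[of _ ?W] exI[of _ ?\<Psi>] exI[of _ ?T]) simp
qed

section \<open>The surface as a symplectic manifold in base coordinates\<close>

lemma surface_atlas_sel [simp]:
  "pts (surface_atlas M \<rho>) = subtopology total.gen_top (constraint_surface M \<rho>)"
  "chart_dom (surface_atlas M \<rho>) \<alpha> = constraint_surface M \<rho> \<inter> bundle_dom M \<rho> \<alpha>"
  "chart (surface_atlas M \<rho>) \<alpha> e = chart M \<alpha> (bundle_proj e)"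
  by (simp_all add: surface_atlas_def)

lemma topspace_surface: "topspace (pts (surface_atlas M \<rho>)) = constraint_surface M \<rho>"
  using constraint_surface_subset topspace_bundle by auto

lemma continuous_bundle_proj: "continuous_map (pts (surface_atlas M \<rho>)) (pts M) bundle_proj"
  using smooth_bundle_proj unfolding smooth_map_def
  by (auto intro: continuous_map_from_subtopology)

lemma homeomorphic_maps_surface:
  "homeomorphic_maps (pts (surface_atlas M \<rho>)) (pts M) bundle_proj (surface_section M \<rho>)"
  unfolding homeomorphic_maps_def topspace_surface
proof (intro conjI ballI)
  show "continuous_map (pts M) (pts (surface_atlas M \<rho>)) (surface_section M \<rho>)"
    using continuous_section section_in_surface by (auto simp: continuous_map_in_subtopology)
qed (simp_all add: continuous_bundle_proj del: surface_atlas_sel)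

lemma surface_dom_proj:
  "bundle_proj ` (constraint_surface M \<rho> \<inter> bundle_dom M \<rho> \<alpha>) = chart_dom M \<alpha>"
proof
  show "chart_dom M \<alpha> \<subseteq> bundle_proj ` (constraint_surface M \<rho> \<inter> bundle_dom M \<rho> \<alpha>)"
  proof
    fix m assume m: "m \<in> chart_dom M \<alpha>"
    then have "m \<in> topspace (pts M)" by (rule in_topspace)
    then show "m \<in> bundle_proj ` (constraint_surface M \<rho> \<inter> bundle_dom M \<rho> \<alpha>)"
      using m by (intro image_eqI[of _ _ "surface_section M \<rho> m"])
        (auto simp: section_in_surface section_in_dom_iff)
  qed
qed (auto simp: bundle_proj_in)

text \<open>The equality of coordinate domains is what allows the component functions
  \<open>\<omega> \<alpha>\<close> to be reused unchanged as a form on the surface.\<close>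

lemma surface_chart_img: "chart_img (surface_atlas M \<rho>) \<alpha> = chart_img M \<alpha>"
  unfolding chart_img_def surface_atlas_sel surface_dom_proj[of \<alpha>, symmetric] by auto

lemma inj_surface_chart:
  "inj_on (chart (surface_atlas M \<rho>) \<alpha>) (chart_dom (surface_atlas M \<rho>) \<alpha>)"
proof (rule inj_onI)
  fix e e' assume *: "e \<in> chart_dom (surface_atlas M \<rho>) \<alpha>" "e' \<in> chart_dom (surface_atlas M \<rho>) \<alpha>"
    and "chart (surface_atlas M \<rho>) \<alpha> e = chart (surface_atlas M \<rho>) \<alpha> e'"
  then have "bundle_proj e = bundle_proj e'"
    using inj_onD[OF inj_chart] bundle_proj_in by auto
  then show "e = e'"
    using * section_bundle_proj by (metis Int_iff surface_atlas_sel(2))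
qed

lemma surface_chart_inv [simp]:
  assumes "x \<in> chart_img M \<alpha>"
  shows "chart_inv (surface_atlas M \<rho>) \<alpha> x = surface_section M \<rho> (chart_inv M \<alpha> x)"
  unfolding chart_inv_def[of "surface_atlas M \<rho>"]
  using assms in_topspace[OF chart_inv_in[OF assms]]
  by (intro inv_into_f_eq inj_surface_chart) (auto simp: section_in_surface section_in_dom_iff)

lemma surface_overlap:
  "chart (surface_atlas M \<rho>) \<alpha> ` (chart_dom (surface_atlas M \<rho>) \<alpha> \<inter> chart_dom (surface_atlas M \<rho>) \<beta>)
    = overlap \<alpha> \<beta>"
proof -
  have "bundle_proj ` (chart_dom (surface_atlas M \<rho>) \<alpha> \<inter> chart_dom (surface_atlas M \<rho>) \<beta>)
      = bundle_proj ` (chart_dom (surface_atlas M \<rho>) \<alpha>) \<inter> chart_dom M \<beta>"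
    using constraint_surface_subset by (auto simp: bundle_dom_def)
  also have "\<dots> = chart_dom M \<alpha> \<inter> chart_dom M \<beta>"
    by (simp add: surface_dom_proj)
  finally show ?thesis
    by (metis (no_types, lifting) image_cong image_image surface_atlas_sel(3))
qed

text \<open>Surface charts read off only the base point, so the section and its inverse disappear in
  coordinates. Smoothness of the surface atlas and of the section in both directions thereby becomes
  smoothness of the coordinate changes of \<open>M\<close>.\<close>

lemma local_rep_surface:
  assumes "x \<in> chart_img M \<alpha>"
  shows "local_rep (surface_atlas M \<rho>) \<alpha> (surface_atlas M \<rho>) \<beta> (\<lambda>m. m) x = change \<alpha> \<beta> x"
    and "local_rep M \<alpha> (surface_atlas M \<rho>) \<beta> (surface_section M \<rho>) x = change \<alpha> \<beta> x"
    and "local_rep (surface_atlas M \<rho>) \<alpha> M \<beta>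
      (inv_into (topspace (pts M)) (surface_section M \<rho>)) x = change \<alpha> \<beta> x"
proof -
  have m: "chart_inv M \<alpha> x \<in> topspace (pts M)"
    using assms chart_inv_in in_topspace by blast
  have "inj_on (surface_section M \<rho>) (topspace (pts M))"
    by (metis bundle_proj_section inj_onI)
  then have "inv_into (topspace (pts M)) (surface_section M \<rho>) (surface_section M \<rho> (chart_inv M \<alpha> x))
      = chart_inv M \<alpha> x"
    using m by (rule inv_into_f_f)
  with m show "local_rep (surface_atlas M \<rho>) \<alpha> (surface_atlas M \<rho>) \<beta> (\<lambda>m. m) x = change \<alpha> \<beta> x"
    "local_rep M \<alpha> (surface_atlas M \<rho>) \<beta> (surface_section M \<rho>) x = change \<alpha> \<beta> x"
    "local_rep (surface_atlas M \<rho>) \<alpha> M \<beta>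
      (inv_into (topspace (pts M)) (surface_section M \<rho>)) x = change \<alpha> \<beta> x"
    using assms by (simp_all add: local_rep_def)
qed

lemma overlap_subset: "overlap \<alpha> \<beta> \<subseteq> chart_img M \<alpha>"
  by (auto simp: chart_img_def)

lemma smooth_manifold_surface: "smooth_manifold (surface_atlas M \<rho>)"
  unfolding smooth_manifold_def
proof (intro conjI allI)
  let ?L = "surface_atlas M \<rho>"
  show "Hausdorff_space (pts ?L)" "second_countable (pts ?L)"
    by (simp_all add: Hausdorff_space_subtopology Hausdorff_bundle second_countable_subtopology
        second_countable_bundle)
  show "(\<Union>\<alpha>. chart_dom ?L \<alpha>) = topspace (pts ?L)"
    unfolding topspace_surface using constraint_surface_subset bundle_pts_eq by auto
  fix \<alpha> \<beta>
  show "openin (pts ?L) (chart_dom ?L \<alpha>)"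
    using total.openin_dom[of \<alpha>] by (auto simp: openin_subtopology)
  show "open (chart_img ?L \<alpha>)"
    by (simp add: surface_chart_img open_chart_img)
  have "homeomorphic_map (subtopology (pts ?L) (chart_dom ?L \<alpha>)) (subtopology (pts M) (chart_dom M \<alpha>)) bundle_proj"
  proof (rule homeomorphic_map_subtopologies)
    show "homeomorphic_map (pts ?L) (pts M) bundle_proj"
      using homeomorphic_maps_surface homeomorphic_maps_imp_map by blast
    have "topspace (pts ?L) \<inter> chart_dom ?L \<alpha> = constraint_surface M \<rho> \<inter> bundle_dom M \<rho> \<alpha>"
      unfolding topspace_surface by auto
    moreover have "topspace (pts M) \<inter> chart_dom M \<alpha> = chart_dom M \<alpha>"
      using in_topspace by blast
    ultimately show "bundle_proj ` (topspace (pts ?L) \<inter> chart_dom ?L \<alpha>) = topspace (pts M) \<inter> chart_dom M \<alpha>"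
      by (simp only: surface_dom_proj)
  qed
  from homeomorphic_map_compose[OF this homeo]
  show "homeomorphic_map (subtopology (pts ?L) (chart_dom ?L \<alpha>)) (top_of_set (chart_img ?L \<alpha>)) (chart ?L \<alpha>)"
    unfolding surface_chart_img by (rule homeomorphic_map_eq) simp
  show "smooth_on (chart ?L \<alpha> ` (chart_dom ?L \<alpha> \<inter> chart_dom ?L \<beta>)) (local_rep ?L \<alpha> ?L \<beta> (\<lambda>m. m))"
    unfolding surface_overlap using overlap_subset
    by (intro smooth_on_cong[OF open_overlap smooth_change] local_rep_surface[symmetric]) blast
qed

lemma diffeomorphism_section: "diffeomorphism M (surface_atlas M \<rho>) (surface_section M \<rho>)"
  unfolding diffeomorphism_def smooth_map_def
proof (intro conjI allI)
  let ?L = "surface_atlas M \<rho>" and ?s = "surface_section M \<rho>"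
  have inj: "inj_on ?s (topspace (pts M))"
    by (metis bundle_proj_section inj_onI)
  then show "bij_betw ?s (topspace (pts M)) (topspace (pts ?L))"
    unfolding topspace_surface bij_betw_def using section_image by blast
  show "continuous_map (pts M) (pts ?L) ?s"
    using homeomorphic_maps_surface homeomorphic_maps_def by blast
  have inv: "inv_into (topspace (pts M)) ?s e = bundle_proj e" if "e \<in> constraint_surface M \<rho>" for e
    using that inj by (intro inv_into_f_eq) (simp_all add: bundle_proj_surface)
  then show "continuous_map (pts ?L) (pts M) (inv_into (topspace (pts M)) ?s)"
    using continuous_map_eq[OF continuous_bundle_proj] topspace_surface by metis
  fix \<alpha> \<beta>
  have 1: "{m \<in> chart_dom M \<alpha>. ?s m \<in> chart_dom ?L \<beta>} = chart_dom M \<alpha> \<inter> chart_dom M \<beta>"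
    by (auto simp: section_in_dom_iff section_in_surface in_topspace)
  show "smooth_on (chart M \<alpha> ` {m \<in> chart_dom M \<alpha>. ?s m \<in> chart_dom ?L \<beta>}) (local_rep M \<alpha> ?L \<beta> ?s)"
    unfolding 1 using overlap_subset
    by (intro smooth_on_cong[OF open_overlap smooth_change] local_rep_surface[symmetric]) blast
  have 2: "{e \<in> chart_dom ?L \<alpha>. inv_into (topspace (pts M)) ?s e \<in> chart_dom M \<beta>}
      = chart_dom ?L \<alpha> \<inter> chart_dom ?L \<beta>"
    using inv constraint_surface_subset by (auto simp: bundle_dom_def)
  show "smooth_on (chart ?L \<alpha> ` {e \<in> chart_dom ?L \<alpha>. inv_into (topspace (pts M)) ?s e \<in> chart_dom M \<beta>})
      (local_rep ?L \<alpha> M \<beta> (inv_into (topspace (pts M)) ?s))"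
    unfolding 2 surface_overlap using overlap_subset
    by (intro smooth_on_cong[OF open_overlap smooth_change] local_rep_surface[symmetric]) blast
qed

lemma jacobian_local_rep:
  assumes "m \<in> chart_dom M \<alpha>" "m \<in> chart_dom M \<beta>" "\<And>x. x \<in> chart_img M \<alpha> \<Longrightarrow> F x = change \<alpha> \<beta> x"
  shows "jacobian F (at (chart M \<alpha> m)) = jacobian (change \<alpha> \<beta>) (at (chart M \<alpha> m))"
  using frechet_derivative_cong[of "change \<alpha> \<beta>" _ "chart_img M \<alpha>" F] assms
    change_differentiable open_chart_img
  by (simp add: jacobian_def)

lemma pullback_surface:
  assumes "pullback_form M \<omega> M \<omega> (\<lambda>m. m)"
  shows "pullback_form M \<omega> (surface_atlas M \<rho>) \<omega> (surface_section M \<rho>)"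
    and "pullback_form (surface_atlas M \<rho>) \<omega> (surface_atlas M \<rho>) \<omega> (\<lambda>m. m)"
proof -
  \<comment> \<open>Both claims are the transformation law of \<open>\<omega>\<close> on
    \<open>M\<close>, with the coordinate change replaced by a map \<open>F\<close> that agrees with
    it on the chart image.\<close>
  have *: "\<omega> \<alpha> (chart M \<alpha> m) = transpose J ** \<omega> \<beta> (chart M \<beta> m) ** J"
    if "m \<in> chart_dom M \<alpha>" "m \<in> chart_dom M \<beta>" "\<And>x. x \<in> chart_img M \<alpha> \<Longrightarrow> F x = change \<alpha> \<beta> x"
      "J = jacobian F (at (chart M \<alpha> m))" for \<alpha> \<beta> m F J
  proof -
    have "J = jacobian (change \<alpha> \<beta>) (at (chart M \<alpha> m))"
      unfolding that(4) by (rule jacobian_local_rep) (fact that)+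
    then show ?thesis
      using assms that(1,2) unfolding pullback_form_def Let_def by blast
  qed
  show "pullback_form M \<omega> (surface_atlas M \<rho>) \<omega> (surface_section M \<rho>)"
    unfolding pullback_form_def Let_def
  proof (intro allI ballI impI)
    fix \<alpha> \<beta> m
    assume m: "m \<in> chart_dom M \<alpha>" "surface_section M \<rho> m \<in> chart_dom (surface_atlas M \<rho>) \<beta>"
    then have m': "m \<in> topspace (pts M)" "m \<in> chart_dom M \<beta>"
      using in_topspace section_in_dom_iff by auto
    show "\<omega> \<alpha> (chart M \<alpha> m) =
        transpose (jacobian (local_rep M \<alpha> (surface_atlas M \<rho>) \<beta> (surface_section M \<rho>)) (at (chart M \<alpha> m))) **
        \<omega> \<beta> (chart (surface_atlas M \<rho>) \<beta> (surface_section M \<rho> m)) **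
        jacobian (local_rep M \<alpha> (surface_atlas M \<rho>) \<beta> (surface_section M \<rho>)) (at (chart M \<alpha> m))"
      using *[OF m(1) m'(2) local_rep_surface(2) refl] m'(1) by simp
  qed
  show "pullback_form (surface_atlas M \<rho>) \<omega> (surface_atlas M \<rho>) \<omega> (\<lambda>m. m)"
    unfolding pullback_form_def Let_def surface_atlas_sel
    by (intro allI ballI impI *[OF _ _ local_rep_surface(1) refl]) (auto simp: bundle_proj_in)
qed

text \<open>Smoothness, skewness, closedness and invertibility concern the same components on the
  same coordinate sets and are inherited as they stand; the transformation law is the part that was
  transferred by \<open>pullback_surface\<close>.\<close>

lemma symplectic_surface:
  assumes "symplectic_form M \<omega>"
  shows "symplectic_manifold (surface_atlas M \<rho>) \<omega>"
  using assms smooth_manifold_surface pullback_surface(2)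
  unfolding symplectic_manifold_def symplectic_form_def surface_chart_img by blast

end


section \<open>The Dirac bracket\<close>

lemma matrix_inv_inverse:
  assumes "invertible A"
  shows "A ** matrix_inv A = mat 1" "matrix_inv A ** A = mat 1"
proof -
  have "\<exists>A'. A ** A' = mat 1 \<and> A' ** A = mat 1"
    using assms by (simp add: invertible_def)
  from someI_ex[OF this] show "A ** matrix_inv A = mat 1" "matrix_inv A ** A = mat 1"
    by (simp_all add: matrix_inv_def)
qed

text \<open>The two orders of factors are those of \<open>symplectic_bracket\<close> and
  \<open>dirac_bracket\<close>.\<close>

lemma sum_bilinear_form:
  fixes A :: "real^'n^'n"
  shows "(\<Sum>i\<in>UNIV. \<Sum>j\<in>UNIV. A $ i $ j * a i * b j) = (\<chi> i. a i) \<bullet> (A *v (\<chi> j. b j))"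
    and "(\<Sum>i\<in>UNIV. \<Sum>j\<in>UNIV. a i * A $ i $ j * b j) = (\<chi> i. a i) \<bullet> (A *v (\<chi> j. b j))"
  by (simp_all add: inner_vec_def matrix_vector_mult_def sum_distrib_left mult_ac)

text \<open>With \<open>a = f\<^sub>x\<close>, \<open>b = f\<^sub>p\<close>, \<open>c = g\<^sub>x\<close>, \<open>d = g\<^sub>p\<close> and \<open>N\<close> the Jacobian of \<open>\<rho>\<close>, the left-hand side is
  the Dirac bracket and the vectors on the right are the gradients of \<open>f\<^sub>0\<close> and \<open>g\<^sub>0\<close>.\<close>

lemma dirac_bracket_algebra:
  fixes N A W :: "real^'n^'n"
  assumes W: "W = transpose N - N" and inv: "W ** A = mat 1" "A ** W = mat 1"
  shows "a \<bullet> d - b \<bullet> c + (a + N *v b) \<bullet> (A *v (c + N *v d)) = (a + b v* N) \<bullet> (A *v (c + d v* N))"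
proof -
  \<comment> \<open>Here \<open>x v* N\<close> is the transpose of \<open>N\<close> applied to
    \<open>x\<close>. With \<open>u = a + N *v b\<close> and \<open>v = c + N *v d\<close> the
    right-hand side becomes a pairing of \<open>u + W *v b\<close> with
    \<open>A *v (v + W *v d)\<close>, and its cross terms simplify by skewness of \<open>W\<close>
    and \<open>A\<close> being its inverse.\<close>
  have split: "x v* N = N *v x + W *v x" for x
    by (simp add: W matrix_vector_mult_diff_rdistrib)
  have W_skew: "(W *v x) \<bullet> y = - (x \<bullet> (W *v y))" for x y
  proof -
    have "(N *v x) \<bullet> y = x \<bullet> (y v* N)"
      using dot_lmul_matrix[of y N x] by (simp add: inner_commute)
    then show ?thesis
      using dot_lmul_matrix[of x N y]
      by (simp add: W matrix_vector_mult_diff_rdistrib inner_diff_left inner_diff_right)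
  qed
  have AW: "A *v (W *v x) = x" and WA: "W *v (A *v x) = x" for x
    by (simp_all add: matrix_vector_mul_assoc inv)
  \<comment> \<open>The expansion leaves
    \<open>u \<bullet> d - b \<bullet> v + (W *v b) \<bullet> d\<close>; by this identity all terms
    containing \<open>N\<close> cancel and \<open>a \<bullet> d - b \<bullet> c\<close>
    remains.\<close>
  have "(W *v b) \<bullet> d = b \<bullet> (N *v d) - (N *v b) \<bullet> d"
    using dot_lmul_matrix[of b N d] by (simp add: split inner_add_left)
  then show ?thesis
    unfolding split
    by (simp add: matrix_vector_right_distrib AW inner_add_left inner_add_right W_skew WA)
qed

locale symplectic_potential_manifold = potential_manifold M \<rho>
  for M :: "('a, 'm, real^'n) atlas" and \<rho> :: "'a \<Rightarrow> real^'n \<Rightarrow> real^'n" +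
  fixes \<omega> :: "'a \<Rightarrow> real^'n \<Rightarrow> real^'n^'n"
  assumes form: "symplectic_form M \<omega>" and potential: "symplectic_potential M \<omega> \<rho>"
begin

abbreviation dpot :: "'a \<Rightarrow> real^'n \<Rightarrow> real^'n^'n" where
  "dpot \<alpha> x \<equiv> jacobian (\<rho> \<alpha>) (at x)"

definition bundle_rep ::
  "'a \<Rightarrow> (('a \<times> 'm \<times> (real^'n)) set \<Rightarrow> real) \<Rightarrow> (real^'n) \<times> (real^'n) \<Rightarrow> real" where
  "bundle_rep \<alpha> f = f \<circ> chart_inv (affine_bundle M \<rho>) \<alpha>"

definition grad_x ::
  "'a \<Rightarrow> (('a \<times> 'm \<times> (real^'n)) set \<Rightarrow> real) \<Rightarrow> (real^'n) \<times> (real^'n) \<Rightarrow> real^'n" where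
  "grad_x \<alpha> f y = (\<chi> i. partial_x i (bundle_rep \<alpha> f) y)"

definition grad_p ::
  "'a \<Rightarrow> (('a \<times> 'm \<times> (real^'n)) set \<Rightarrow> real) \<Rightarrow> (real^'n) \<times> (real^'n) \<Rightarrow> real^'n" where
  "grad_p \<alpha> f y = (\<chi> i. partial_p i (bundle_rep \<alpha> f) y)"

section \<open>Brackets expressed by coordinate gradients\<close>

lemma canonical_bracket_grad:
  "canonical_bracket M \<rho> \<alpha> f g e
    = grad_x \<alpha> f (bundle_chart M \<alpha> e) \<bullet> grad_p \<alpha> g (bundle_chart M \<alpha> e)
      - grad_p \<alpha> f (bundle_chart M \<alpha> e) \<bullet> grad_x \<alpha> g (bundle_chart M \<alpha> e)"
  by (simp add: canonical_bracket_def Let_def grad_x_def grad_p_def bundle_rep_def inner_vec_def sum_subtractf)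

lemma potential_has_derivative:
  "x \<in> chart_img M \<alpha> \<Longrightarrow> (\<rho> \<alpha> has_derivative frechet_derivative (\<rho> \<alpha>) (at x)) (at x)"
  by (rule smooth_on_has_derivative[OF smooth_potential])

text \<open>The row index of a Jacobian counts components and the column index directions, so the
  derivative of the \<open>j\<close>-th component in direction \<open>i\<close> is an entry of the
  transpose; this fixes the sign.\<close>

lemma form_eq_dpot:
  assumes "x \<in> chart_img M \<alpha>"
  shows "\<omega> \<alpha> x = transpose (dpot \<alpha> x) - dpot \<alpha> x"
proof -
  have "partial i (\<lambda>y. \<rho> \<alpha> y $ j) x = dpot \<alpha> x $ j $ i" for i j
    unfolding partial_def jacobian_nth
    using frechet_derivative_at[OF bounded_linear.has_derivative[OF bounded_linear_vec_nth
          potential_has_derivative[OF assms]], of j] by metis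
  then show ?thesis
    using potential assms by (simp add: symplectic_potential_def vec_eq_iff transpose_def)
qed

lemma invertible_form: "x \<in> chart_img M \<alpha> \<Longrightarrow> invertible (\<omega> \<alpha> x)"
  using form by (simp add: symplectic_form_def)

lemma grad_constraint:
  assumes "x \<in> chart_img M \<alpha>"
  shows "grad_x \<alpha> (constraint M \<rho> \<alpha> i) (x, p) = dpot \<alpha> x $ i"
    and "grad_p \<alpha> (constraint M \<rho> \<alpha> i) (x, p) = - axis i 1"
proof -
  let ?S = "chart_img M \<alpha> \<times> (UNIV :: (real^'n) set)"
  let ?D = "\<lambda>v. frechet_derivative (\<rho> \<alpha>) (at x) (fst v) $ i - snd v $ i"
  have S: "open ?S"
    by (intro open_Times open_chart_img open_UNIV)
  have "((\<lambda>y. \<rho> \<alpha> (fst y)) has_derivative (\<lambda>v. frechet_derivative (\<rho> \<alpha>) (at x) (fst v))) (at (x, p))"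
    by (rule has_derivative_compose[of fst fst]) (simp_all add: has_derivative_fst potential_has_derivative assms)
  then have "((\<lambda>y. \<rho> \<alpha> (fst y) $ i - snd y $ i) has_derivative ?D) (at (x, p))"
    by (intro has_derivative_diff bounded_linear.has_derivative[OF bounded_linear_vec_nth]
        has_derivative_snd has_derivative_ident)
  then have "(bundle_rep \<alpha> (constraint M \<rho> \<alpha> i) has_derivative ?D) (at (x, p))"
    by (rule has_derivative_transform_within_open[OF _ S])
      (auto simp: assms bundle_rep_def bundle_chart_inv)
  then have D: "frechet_derivative (bundle_rep \<alpha> (constraint M \<rho> \<alpha> i)) (at (x, p)) = ?D"
    by (rule frechet_derivative_at[symmetric])
  have "frechet_derivative (\<rho> \<alpha>) (at x) 0 = 0"
    using potential_has_derivative[OF assms] has_derivative_linear linear_0 by blast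
  then show "grad_x \<alpha> (constraint M \<rho> \<alpha> i) (x, p) = dpot \<alpha> x $ i"
    and "grad_p \<alpha> (constraint M \<rho> \<alpha> i) (x, p) = - axis i 1"
    by (auto simp: grad_x_def grad_p_def partial_x_def partial_p_def D vec_eq_iff jacobian_nth axis_def)
qed

lemma bracket_constraint:
  assumes "e \<in> bundle_dom M \<rho> \<alpha>" "y = bundle_chart M \<alpha> e"
  shows "canonical_bracket M \<rho> \<alpha> f (constraint M \<rho> \<alpha> i) e
      = - (grad_x \<alpha> f y + dpot \<alpha> (fst y) *v grad_p \<alpha> f y) $ i"
    and "canonical_bracket M \<rho> \<alpha> (constraint M \<rho> \<alpha> i) f e
      = (grad_x \<alpha> f y + dpot \<alpha> (fst y) *v grad_p \<alpha> f y) $ i"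
proof -
  have x: "fst y \<in> chart_img M \<alpha>"
    using assms by (simp add: bundle_chart_def bundle_proj_in)
  show "canonical_bracket M \<rho> \<alpha> (constraint M \<rho> \<alpha> i) f e
      = (grad_x \<alpha> f y + dpot \<alpha> (fst y) *v grad_p \<alpha> f y) $ i"
    using grad_constraint[OF x, of i "snd y"]
    by (simp add: canonical_bracket_grad assms(2)[symmetric] inner_axis' matrix_vector_mul_component)
  then show "canonical_bracket M \<rho> \<alpha> f (constraint M \<rho> \<alpha> i) e
      = - (grad_x \<alpha> f y + dpot \<alpha> (fst y) *v grad_p \<alpha> f y) $ i"
    by (simp add: canonical_bracket_grad inner_commute)
qed

text \<open>Since a constraint has gradients \<open>dpot \<alpha> x $ i\<close> and
  \<open>- axis i 1\<close>, the bracket is an entry of the transpose of \<open>dpot\<close> minus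
  the same entry of \<open>dpot\<close>. The fibre coordinate does not enter, so the identity also
  holds off the surface.\<close>

lemma bracket_constraint_constraint:
  assumes "e \<in> bundle_dom M \<rho> \<alpha>"
  shows "canonical_bracket M \<rho> \<alpha> (constraint M \<rho> \<alpha> i) (constraint M \<rho> \<alpha> j) e
    = \<omega> \<alpha> (chart M \<alpha> (bundle_proj e)) $ i $ j"
proof -
  have x: "chart M \<alpha> (bundle_proj e) \<in> chart_img M \<alpha>"
    using assms by (simp add: bundle_proj_in)
  show ?thesis
    by (simp add: bracket_constraint(2)[OF assms refl] bundle_chart_def grad_constraint[OF x]
        form_eq_dpot[OF x] transpose_def matrix_vector_mul_component inner_axis)
qed

lemma second_class: "constraints_second_class M \<rho>"
  unfolding constraints_second_class_def
proof (intro allI ballI)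
  fix \<alpha> e assume e: "e \<in> bundle_dom M \<rho> \<alpha>"
  have "constraint_matrix M \<rho> \<alpha> e = \<omega> \<alpha> (chart M \<alpha> (bundle_proj e))"
    by (simp add: constraint_matrix_def vec_eq_iff bracket_constraint_constraint[OF e])
  then show "invertible (constraint_matrix M \<rho> \<alpha> e)"
    using e by (simp add: invertible_form bundle_proj_in)
qed

text \<open>In coordinates the restriction is \<open>bundle_rep \<alpha> f\<close> composed with the
  graph map of \<open>\<rho> \<alpha>\<close>, so the chain rule applies.\<close>

lemma restriction_has_derivative:
  assumes "smooth_fun (affine_bundle M \<rho>) f" "x \<in> chart_img M \<alpha>"
  shows "(f \<circ> surface_section M \<rho> \<circ> chart_inv M \<alpha> has_derivative
    (\<lambda>v. frechet_derivative (bundle_rep \<alpha> f) (at (x, \<rho> \<alpha> x)) (v, frechet_derivative (\<rho> \<alpha>) (at x) v))) (at x)"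
proof -
  have F: "(bundle_rep \<alpha> f has_derivative frechet_derivative (bundle_rep \<alpha> f) (at (x, \<rho> \<alpha> x))) (at (x, \<rho> \<alpha> x))"
    using assms unfolding smooth_fun_def bundle_rep_def bundle_chart_img
    by (intro smooth_on_has_derivative[of "chart_img M \<alpha> \<times> UNIV"]) auto
  have "((\<lambda>x. (x, \<rho> \<alpha> x)) has_derivative (\<lambda>v. (v, frechet_derivative (\<rho> \<alpha>) (at x) v))) (at x)"
    by (intro has_derivative_Pair has_derivative_ident potential_has_derivative assms)
  from has_derivative_compose[OF this F] show ?thesis
    by (rule has_derivative_transform_within_open[OF _ open_chart_img assms(2)])
      (simp add: bundle_rep_def bundle_chart_inv surface_section_eq[OF chart_inv_in])
qed

lemma partial_restriction:
  assumes "smooth_fun (affine_bundle M \<rho>) f" "x \<in> chart_img M \<alpha>"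
  shows "(\<chi> i. partial i (f \<circ> surface_section M \<rho> \<circ> chart_inv M \<alpha>) x)
    = grad_x \<alpha> f (x, \<rho> \<alpha> x) + grad_p \<alpha> f (x, \<rho> \<alpha> x) v* dpot \<alpha> x"
proof -
  define D where "D = frechet_derivative (bundle_rep \<alpha> f) (at (x, \<rho> \<alpha> x))"
  have "bundle_rep \<alpha> f differentiable (at (x, \<rho> \<alpha> x))"
    using assms smooth_on_has_derivative[of "chart_img M \<alpha> \<times> UNIV" "bundle_rep \<alpha> f" "(x, \<rho> \<alpha> x)"]
    unfolding smooth_fun_def bundle_rep_def bundle_chart_img differentiable_def by auto
  then interpret D: linear D
    unfolding D_def by (rule linear_frechet_derivative)
  \<comment> \<open>The fibre component of a tangent vector to the graph is a derivative of
    \<open>\<rho>\<close>; expanding it along the axes produces the contraction of the fibre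
    gradient with \<open>dpot\<close>.\<close>
  have D_p: "D (0, w) = (\<Sum>k\<in>UNIV. w $ k * D (0, axis k 1))" for w :: "real^'n"
  proof -
    have "(0, w) = (\<Sum>k\<in>UNIV. w $ k *\<^sub>R (0 :: real^'n, axis k 1 :: real^'n))"
      by (simp add: prod_eq_iff fst_sum snd_sum basis_expansion flip: scalar_mult_eq_scaleR)
    then show ?thesis
      by (simp only: D.sum D.scaleR) simp
  qed
  have "partial i (f \<circ> surface_section M \<rho> \<circ> chart_inv M \<alpha>) x
      = D (axis i 1, 0) + (\<Sum>k\<in>UNIV. frechet_derivative (\<rho> \<alpha>) (at x) (axis i 1) $ k * D (0, axis k 1))" for i
  proof -
    let ?w = "frechet_derivative (\<rho> \<alpha>) (at x) (axis i 1)"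
    have "partial i (f \<circ> surface_section M \<rho> \<circ> chart_inv M \<alpha>) x = D (axis i 1, ?w)"
      unfolding partial_def D_def frechet_derivative_at[OF restriction_has_derivative[OF assms], symmetric]
      by (rule refl)
    also have "\<dots> = D (axis i 1, 0) + D (0, ?w)"
      using D.add[of "(axis i 1, 0)" "(0, ?w)"] by simp
    finally show ?thesis
      unfolding D_p[of ?w] .
  qed
  then show ?thesis
    by (simp add: vec_eq_iff grad_x_def grad_p_def partial_x_def partial_p_def D_def
        vector_matrix_mult_def jacobian_nth mult.commute)
qed

lemma dirac_bracket_restriction:
  assumes f: "smooth_fun (affine_bundle M \<rho>) f" and g: "smooth_fun (affine_bundle M \<rho>) g"
    and m: "m \<in> chart_dom M \<alpha>"
  shows "dirac_bracket M \<omega> \<rho> \<alpha> f g (surface_section M \<rho> m)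
    = symplectic_bracket M \<omega> \<alpha> (f \<circ> surface_section M \<rho>) (g \<circ> surface_section M \<rho>) m"
proof -
  let ?e = "surface_section M \<rho> m" and ?x = "chart M \<alpha> m"
  let ?y = "(?x, \<rho> \<alpha> ?x)" and ?A = "matrix_inv (\<omega> \<alpha> (chart M \<alpha> m))" and ?N = "dpot \<alpha> (chart M \<alpha> m)"
  have m': "m \<in> topspace (pts M)"
    using m by (rule in_topspace)
  have e: "?e \<in> bundle_dom M \<rho> \<alpha>" and y: "?y = bundle_chart M \<alpha> ?e"
    using m m' by (simp_all add: section_in_dom_iff bundle_chart_section)
  have x: "?x \<in> chart_img M \<alpha>"
    using m by simp
  \<comment> \<open>The correction enters with a plus sign: the minus of the Dirac bracket meets the
    minus in the bracket of \<open>f\<close> with a constraint.\<close>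
  have "dirac_bracket M \<omega> \<rho> \<alpha> f g ?e
      = grad_x \<alpha> f ?y \<bullet> grad_p \<alpha> g ?y - grad_p \<alpha> f ?y \<bullet> grad_x \<alpha> g ?y
        + (grad_x \<alpha> f ?y + ?N *v grad_p \<alpha> f ?y) \<bullet> (?A *v (grad_x \<alpha> g ?y + ?N *v grad_p \<alpha> g ?y))"
  proof -
    have "(\<chi> i. canonical_bracket M \<rho> \<alpha> f (constraint M \<rho> \<alpha> i) ?e)
        = - (grad_x \<alpha> f ?y + ?N *v grad_p \<alpha> f ?y)"
      "(\<chi> i. canonical_bracket M \<rho> \<alpha> (constraint M \<rho> \<alpha> i) g ?e)
        = grad_x \<alpha> g ?y + ?N *v grad_p \<alpha> g ?y"
      using bracket_constraint[OF e y] by (simp_all add: vec_eq_iff)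
    then show ?thesis
      unfolding dirac_bracket_def sum_bilinear_form(2) canonical_bracket_grad[of \<alpha> f g] y[symmetric]
      using m' by (simp only: bundle_proj_section inner_minus_left)
  qed
  also have "\<dots> = (grad_x \<alpha> f ?y + grad_p \<alpha> f ?y v* ?N) \<bullet> (?A *v (grad_x \<alpha> g ?y + grad_p \<alpha> g ?y v* ?N))"
    using matrix_inv_inverse[OF invertible_form[OF x]]
    by (intro dirac_bracket_algebra[OF form_eq_dpot[OF x]])
  also have "\<dots> = symplectic_bracket M \<omega> \<alpha> (f \<circ> surface_section M \<rho>) (g \<circ> surface_section M \<rho>) m"
    unfolding symplectic_bracket_def Let_def sum_bilinear_form(1)
      partial_restriction[OF f x] partial_restriction[OF g x] ..
  finally show ?thesis .
qed

text \<open>Near the point, \<open>f\<close> in a surface chart is the same coordinate function as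
  its restriction in the chart of \<open>M\<close>, and the form has the same components, so the two
  brackets agree term by term.\<close>

lemma surface_bracket_restriction:
  assumes f: "smooth_fun (affine_bundle M \<rho>) f" and g: "smooth_fun (affine_bundle M \<rho>) g"
    and e: "e \<in> constraint_surface M \<rho>" "e \<in> bundle_dom M \<rho> \<alpha>"
  shows "symplectic_bracket (surface_atlas M \<rho>) \<omega> \<alpha> f g e
    = symplectic_bracket M \<omega> \<alpha> (f \<circ> surface_section M \<rho>) (g \<circ> surface_section M \<rho>) (bundle_proj e)"
proof -
  have x: "chart M \<alpha> (bundle_proj e) \<in> chart_img M \<alpha>"
    using e by (simp add: bundle_proj_in)
  have "partial i (h \<circ> chart_inv (surface_atlas M \<rho>) \<alpha>) (chart M \<alpha> (bundle_proj e))
      = partial i (h \<circ> surface_section M \<rho> \<circ> chart_inv M \<alpha>) (chart M \<alpha> (bundle_proj e))"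
    if h: "smooth_fun (affine_bundle M \<rho>) h" for h i
  proof -
    have "h \<circ> surface_section M \<rho> \<circ> chart_inv M \<alpha> differentiable (at (chart M \<alpha> (bundle_proj e)))"
      using restriction_has_derivative[OF h x] differentiable_def by blast
    from frechet_derivative_cong[OF this open_chart_img x, of "h \<circ> chart_inv (surface_atlas M \<rho>) \<alpha>"]
    show ?thesis
      by (simp add: partial_def)
  qed
  then show ?thesis
    using f g by (simp add: symplectic_bracket_def Let_def)
qed

end

theorem mainTheorem10:
  fixes M :: "('a, 'm, real^'n) atlas"
    and \<omega> :: "'a \<Rightarrow> real^'n \<Rightarrow> real^'n^'n"
    and \<rho> :: "'a \<Rightarrow> real^'n \<Rightarrow> real^'n"
  assumes "symplectic_manifold M \<omega>"
    and "symplectic_potential M \<omega> \<rho>"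
  defines "E \<equiv> affine_bundle M \<rho>"
    and "L \<equiv> constraint_surface M \<rho>"
    and "s \<equiv> surface_section M \<rho>"
  shows "smooth_manifold E \<and> smooth_map E M bundle_proj
    \<and> embedded_submanifold CARD('n) E L
    \<and> smooth_section M \<rho> s \<and> s ` topspace (pts M) = L
    \<and> (\<forall>\<alpha>. \<forall>m \<in> chart_dom M \<alpha>. chart E \<alpha> (s m) = (chart M \<alpha> m, \<rho> \<alpha> (chart M \<alpha> m)))
    \<and> constraints_second_class M \<rho>
    \<and> (\<forall>\<alpha> i j. \<forall>e \<in> chart_dom E \<alpha>.
          canonical_bracket M \<rho> \<alpha> (constraint M \<rho> \<alpha> i) (constraint M \<rho> \<alpha> j) e
          = \<omega> \<alpha> (chart M \<alpha> (bundle_proj e)) $ i $ j)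
    \<and> (\<exists>\<sigma>. symplectic_manifold (surface_atlas M \<rho>) \<sigma>
          \<and> (\<forall>f g. smooth_fun E f \<longrightarrow> smooth_fun E g \<longrightarrow>
               (\<forall>\<alpha>. \<forall>e \<in> L \<inter> chart_dom E \<alpha>.
                  symplectic_bracket (surface_atlas M \<rho>) \<sigma> \<alpha> f g e
                  = dirac_bracket M \<omega> \<rho> \<alpha> f g e))
          \<and> symplectomorphism M \<omega> (surface_atlas M \<rho>) \<sigma> s)
    \<and> (\<forall>f g. smooth_fun E f \<longrightarrow> smooth_fun E g \<longrightarrow>
         (\<forall>\<alpha>. \<forall>m \<in> chart_dom M \<alpha>.
            dirac_bracket M \<omega> \<rho> \<alpha> f g (s m) = symplectic_bracket M \<omega> \<alpha> (f \<circ> s) (g \<circ> s) m))"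
proof -
  interpret symplectic_potential_manifold M \<rho> \<omega>
    using assms(1,2)
    by unfold_locales (auto simp: symplectic_manifold_def symplectic_potential_def)
  \<comment> \<open>On the surface, \<open>e\<close> is the value of the section at
    \<open>bundle_proj e\<close>, where both brackets equal the bracket of the restrictions on
    \<open>M\<close>.\<close>
  have bracket: "symplectic_bracket (surface_atlas M \<rho>) \<omega> \<alpha> f g e = dirac_bracket M \<omega> \<rho> \<alpha> f g e"
    if "smooth_fun E f" "smooth_fun E g" "e \<in> L \<inter> chart_dom E \<alpha>" for f g \<alpha> e
  proof -
    have "e \<in> constraint_surface M \<rho>" "e \<in> bundle_dom M \<rho> \<alpha>"
      using that(3) by (simp_all add: E_def L_def)
    then show ?thesis
      using surface_bracket_restriction[of f g e \<alpha>] dirac_bracket_restriction[of f g "bundle_proj e" \<alpha>]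
        that(1,2) by (simp add: E_def bundle_proj_in)
  qed
  \<comment> \<open>The witness for the form on the surface is \<open>\<omega>\<close> itself, read
    in the base coordinates.\<close>
  have "symplectomorphism M \<omega> (surface_atlas M \<rho>) \<omega> s"
    unfolding symplectomorphism_def s_def
    using diffeomorphism_section pullback_surface(1) form by (simp add: symplectic_form_def)
  then have surface: "\<exists>\<sigma>. symplectic_manifold (surface_atlas M \<rho>) \<sigma>
          \<and> (\<forall>f g. smooth_fun E f \<longrightarrow> smooth_fun E g \<longrightarrow>
               (\<forall>\<alpha>. \<forall>e \<in> L \<inter> chart_dom E \<alpha>.
                  symplectic_bracket (surface_atlas M \<rho>) \<sigma> \<alpha> f g e
                  = dirac_bracket M \<omega> \<rho> \<alpha> f g e))
          \<and> symplectomorphism M \<omega> (surface_atlas M \<rho>) \<sigma> s"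
    using symplectic_surface[OF form] bracket by blast
  show ?thesis
    using surface unfolding E_def L_def s_def
    by (intro conjI smooth_manifold_bundle smooth_bundle_proj embedded_constraint_surface
        smooth_section_surface section_image second_class)
      (simp_all add: bundle_chart_section bracket_constraint_constraint dirac_bracket_restriction)
qed

end
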